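(* Let $p>1$ be a real number and let $G$ be a countably infinite, connected graph of bounded degree without self-loops. Then $HD_p(G)=\mathbb{R}$ (i.e. $HD_p(G)$ consists precisely of the constant functions) if and only if the cardinality of the $p$-harmonic boundary $\partial_p(G)$ is either zero or one.
   Context: Let $V$ be the vertex set of $G$, $N_x$ the set of neighbors of $x\in V$, and $o\in V$ a fixed vertex. Bounded degree means there is an integer $k$ with $\#N_x\le k$ for all $x$. For $f\colon V\to\mathbb{R}$ put $I_p(f,V)=\sum_{x\in V}\sum_{y\in N_x}|f(y)-f(x)|^p$ and $\Delta_p f(x)=\sum_{y\in N_x}|f(y)-f(x)|^{p-2}(f(y)-f(x))$, where a term is $0$ if $f(y)=f(x)$. $f$ is $p$-harmonic if $\Delta_pf(x)=0$ for all $x\in V$. $D_p(G)=\{f\colon V\to\mathbb{R}\mid I_p(f,V)<\infty\}$ with norm $\|f\|_{D_p}=(I_p(f,V)+|f(o)|^p)^{1/p}$; $HD_p(G)$ is the set of $p$-harmonic functions in $D_p(G)$. $\ell^\infty(G)$ is the set of bounded real functions on $V$, and $BD_p(G)=D_p(G)\cap\ell^\infty(G)$, a commutative Banach algebra under pointwise multiplication with norm $\|f\|_{BD_p}=I_p(f,V)^{1/p}+\sup_V|f|$. $\mathbb{R}G$ is the set of finitely supported real functions on $V$, $(\overline{\mathbb{R}G})_{D_p}$ is its closure in $D_p(G)$, and $B(\overline{\mathbb{R}G})_{D_p}=(\overline{\mathbb{R}G})_{D_p}\cap\ell^\infty(G)$. $Sp(BD_p(G))$ is the set of nonzero algebra homomorphisms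 $BD_p(G)\to\mathbb{C}$ with the weak-$*$ topology (pointwise convergence on $BD_p(G)$), a compact Hausdorff space. For $f\in BD_p(G)$, $\hat f(\tau)=\tau(f)$. $V$ is identified with its image in $Sp(BD_p(G))$ under $x\mapsto(f\mapsto f(x))$. The $p$-Royden boundary is $R_p(G)=Sp(BD_p(G))\setminus V$, and the $p$-harmonic boundary is $\partial_p(G)=\{x\in R_p(G)\mid \hat f(x)=0\text{ for all }f\in B(\overline{\mathbb{R}G})_{D_p}\}$. *)

theory Defs
  imports "HOL-Analysis.Analysis"
begin

text \<open>
  A graph is given by its adjacency relation \<open>E\<close> on a vertex type \<open>'v\<close>; the vertex set \<open>V\<close> is
  the whole type. Only neighbour sets enter the definitions, so multiple edges play no role.
\<close>

definition nbrs :: "('v \<Rightarrow> 'v \<Rightarrow> bool) \<Rightarrow> 'v \<Rightarrow> 'v set" where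
  "nbrs E x = {y. E x y}"

definition connected_graph :: "('v \<Rightarrow> 'v \<Rightarrow> bool) \<Rightarrow> bool" where
  "connected_graph E \<longleftrightarrow> (\<forall>x y. E\<^sup>*\<^sup>* x y)"

definition bounded_degree :: "('v \<Rightarrow> 'v \<Rightarrow> bool) \<Rightarrow> bool" where
  "bounded_degree E \<longleftrightarrow> (\<exists>k::nat. \<forall>x. finite (nbrs E x) \<and> card (nbrs E x) \<le> k)"

text \<open>The \<open>p\<close>-Dirichlet sum \<open>I\<^sub>p(f, V)\<close>, with values in \<open>[0, \<infinity>]\<close>.\<close>

definition p_energy :: "('v \<Rightarrow> 'v \<Rightarrow> bool) \<Rightarrow> real \<Rightarrow> ('v \<Rightarrow> real) \<Rightarrow> ennreal" where
  "p_energy E p f = (\<Sum>\<^sub>\<infinity>x\<in>UNIV. \<Sum>y\<in>nbrs E x. ennreal (\<bar>f y - f x\<bar> powr p))"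

text \<open>Summands with \<open>f y = f x\<close> vanish because of the last factor, also when \<open>p < 2\<close>.\<close>

definition p_laplacian :: "('v \<Rightarrow> 'v \<Rightarrow> bool) \<Rightarrow> real \<Rightarrow> ('v \<Rightarrow> real) \<Rightarrow> 'v \<Rightarrow> real" where
  "p_laplacian E p f x = (\<Sum>y\<in>nbrs E x. \<bar>f y - f x\<bar> powr (p - 2) * (f y - f x))"

definition p_harmonic :: "('v \<Rightarrow> 'v \<Rightarrow> bool) \<Rightarrow> real \<Rightarrow> ('v \<Rightarrow> real) \<Rightarrow> bool" where
  "p_harmonic E p f \<longleftrightarrow> (\<forall>x. p_laplacian E p f x = 0)"

definition D_space :: "('v \<Rightarrow> 'v \<Rightarrow> bool) \<Rightarrow> real \<Rightarrow> ('v \<Rightarrow> real) set" where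
  "D_space E p = {f. p_energy E p f < \<infinity>}"

definition HD_space :: "('v \<Rightarrow> 'v \<Rightarrow> bool) \<Rightarrow> real \<Rightarrow> ('v \<Rightarrow> real) set" where
  "HD_space E p = {f \<in> D_space E p. p_harmonic E p f}"

text \<open>Only meaningful on \<open>D_space E p\<close>, since \<open>enn2real \<infinity> = 0\<close>.\<close>

definition D_norm :: "('v \<Rightarrow> 'v \<Rightarrow> bool) \<Rightarrow> real \<Rightarrow> 'v \<Rightarrow> ('v \<Rightarrow> real) \<Rightarrow> real" where
  "D_norm E p o' f = (enn2real (p_energy E p f) + \<bar>f o'\<bar> powr p) powr (1 / p)"

definition bounded_functions :: "('v \<Rightarrow> real) set" where
  "bounded_functions = {f. bounded (range f)}"

definition BD_space :: "('v \<Rightarrow> 'v \<Rightarrow> bool) \<Rightarrow> real \<Rightarrow> ('v \<Rightarrow> real) set" where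
  "BD_space E p = D_space E p \<inter> bounded_functions"

definition finitely_supported :: "('v \<Rightarrow> real) set" where
  "finitely_supported = {f. finite {x. f x \<noteq> 0}}"

definition D_closure_fs :: "('v \<Rightarrow> 'v \<Rightarrow> bool) \<Rightarrow> real \<Rightarrow> 'v \<Rightarrow> ('v \<Rightarrow> real) set" where
  "D_closure_fs E p o' =
     {f \<in> D_space E p. \<forall>\<epsilon>>0. \<exists>g\<in>finitely_supported. D_norm E p o' (\<lambda>x. f x - g x) < \<epsilon>}"

definition BD_closure_fs :: "('v \<Rightarrow> 'v \<Rightarrow> bool) \<Rightarrow> real \<Rightarrow> 'v \<Rightarrow> ('v \<Rightarrow> real) set" where
  "BD_closure_fs E p o' = D_closure_fs E p o' \<inter> bounded_functions"

text \<open>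
  Characters of the real algebra \<open>BD_space E p\<close>: nonzero \<open>\<real>\<close>-linear multiplicative maps into the
  complex numbers. They are taken extensional (\<open>undefined\<close> off \<open>BD_space E p\<close>), so that distinct
  elements of this set are distinct as maps on \<open>BD_space E p\<close>. The Gelfand transform of \<open>f\<close> at
  \<open>\<tau>\<close> is the application \<open>\<tau> f\<close>. The weak-* topology does not enter the definitions below.
\<close>

definition BD_spectrum :: "('v \<Rightarrow> 'v \<Rightarrow> bool) \<Rightarrow> real \<Rightarrow> (('v \<Rightarrow> real) \<Rightarrow> complex) set" where
  "BD_spectrum E p = {\<tau> \<in> extensional (BD_space E p).
     (\<forall>f\<in>BD_space E p. \<forall>g\<in>BD_space E p. \<tau> (\<lambda>x. f x + g x) = \<tau> f + \<tau> g) \<and>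
     (\<forall>c. \<forall>f\<in>BD_space E p. \<tau> (\<lambda>x. c * f x) = complex_of_real c * \<tau> f) \<and>
     (\<forall>f\<in>BD_space E p. \<forall>g\<in>BD_space E p. \<tau> (\<lambda>x. f x * g x) = \<tau> f * \<tau> g) \<and>
     (\<exists>f\<in>BD_space E p. \<tau> f \<noteq> 0)}"

definition point_eval :: "('v \<Rightarrow> 'v \<Rightarrow> bool) \<Rightarrow> real \<Rightarrow> 'v \<Rightarrow> ('v \<Rightarrow> real) \<Rightarrow> complex" where
  "point_eval E p x = (\<lambda>f\<in>BD_space E p. complex_of_real (f x))"

definition royden_boundary :: "('v \<Rightarrow> 'v \<Rightarrow> bool) \<Rightarrow> real \<Rightarrow> (('v \<Rightarrow> real) \<Rightarrow> complex) set" where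
  "royden_boundary E p = BD_spectrum E p - range (point_eval E p)"

definition harmonic_boundary ::
    "('v \<Rightarrow> 'v \<Rightarrow> bool) \<Rightarrow> real \<Rightarrow> 'v \<Rightarrow> (('v \<Rightarrow> real) \<Rightarrow> complex) set" where
  "harmonic_boundary E p o' =
     {\<tau> \<in> royden_boundary E p. \<forall>f\<in>BD_closure_fs E p o'. \<tau> f = 0}"

end

theory Submission
  imports Defs
begin

text \<open>
  Write \<open>BD\<^sub>0\<close> for the bounded functions in the closure of the finitely supported ones. It is an ideal
  of the algebra \<open>BD\<close> of bounded functions of finite energy, and the harmonic boundary consists of
  the characters outside the graph that annihilate it. Both sides of the equivalence say that
  \<open>BD\<close> is, up to \<open>BD\<^sub>0\<close>, the line of constants.
  
  Suppose that all harmonic functions of finite energy are constant. A bounded \<open>f\<close> of finite energy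
  is the sum of an element of \<open>BD\<^sub>0\<close> and a harmonic function \<open>v\<close>, obtained by minimizing the energy over
  \<open>f\<close> plus finitely supported functions (\<open>royden_decomposition\<close>). As \<open>v\<close> is a constant \<open>c\<close>, every
  boundary point takes the value \<open>c\<close> at \<open>f\<close>, and so there is at most one boundary point.
  
  Suppose conversely that there is at most one boundary point. Boundary points detect whether a
  function is in \<open>BD\<^sub>0\<close> up to a uniformly small error (\<open>harmonic_boundary_separates\<close>), because limits
  of vertex evaluations supply enough characters. Hence every \<open>f\<close> in \<open>BD\<close> is, for a suitable
  constant \<open>c\<close> and every \<open>\<epsilon>\<close>, the sum of \<open>c\<close>, an element of \<open>BD\<^sub>0\<close> and the truncation
  \<open>clamp \<epsilon> (f - c)\<close>. The derivative of the energy at a harmonic \<open>h\<close>, the linear form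
  \<open>pairing h\<close>, kills constants and \<open>BD\<^sub>0\<close>, and truncations contribute nothing in the limit
  (\<open>pairing_BD_eq_0\<close>). Applied to truncations of \<open>h\<close> itself this forces \<open>h\<close> to be constant.
  
  Existence of minimizers and the ideal property of \<open>BD\<^sub>0\<close> both rest on the uniform convexity of
  \<open>\<bar>s\<bar> powr p\<close>, through one selection principle (\<open>energy_cauchy_selection\<close>): almost minimizing sequences
  in decreasing midpoint convex sets are Cauchy in energy. It shows that \<open>BD\<^sub>0\<close> is stable under
  pointwise limits with bounded energy (\<open>D_closure_fs_weakI\<close>), from which the algebraic properties
  are immediate.
\<close>

section \<open>Convexity of the power function\<close>

text \<open>
  \<open>p * flux p\<close> is the derivative of \<open>\<bar>s\<bar> powr p\<close>, and \<open>p_laplacian E p f x\<close> is the sum of the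
  fluxes of the differences of \<open>f\<close> along the edges that leave \<open>x\<close>.
\<close>
definition flux :: "real \<Rightarrow> real \<Rightarrow> real" where
  "flux p s = \<bar>s\<bar> powr (p - 2) * s"

lemma flux_minus: "flux p (- s) = - flux p s"
  by (simp add: flux_def)

lemma flux_pos: "s > 0 \<Longrightarrow> flux p s = s powr (p - 1)"
  using powr_add[of s "p - 2" 1] by (simp add: flux_def)

lemma abs_flux: "\<bar>flux p s\<bar> = \<bar>s\<bar> powr (p - 1)"
proof (cases "s = 0")
  case False
  then have "\<bar>flux p s\<bar> = \<bar>s\<bar> powr (p - 2) * \<bar>s\<bar> powr 1"
    by (simp add: flux_def abs_mult)
  also have "\<dots> = \<bar>s\<bar> powr (p - 1)"
    by (subst powr_add[symmetric]) simp
  finally show ?thesis .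
qed (simp add: flux_def)

lemma flux_strict_mono:
  assumes "p > 1" "s < t"
  shows "flux p s < flux p t"
proof -
  have nonneg: "flux p a < flux p b" if "0 \<le> a" "a < b" for a b
  proof (cases "a = 0")
    case True
    with that show ?thesis by (simp add: flux_pos) (simp add: flux_def)
  next
    case False
    with that \<open>p > 1\<close> show ?thesis
      by (simp add: flux_pos powr_less_mono2)
  qed
  consider "0 \<le> s" | "s < 0" "0 < t" | "t \<le> 0" by linarith
  then show ?thesis
  proof cases
    case 1
    with nonneg \<open>s < t\<close> show ?thesis by blast
  next
    case 2
    have "flux p s < 0" "0 < flux p t"
      using 2 by (auto simp: flux_def mult_pos_neg)
    then show ?thesis by linarith
  next
    case 3
    with nonneg[of "- t" "- s"] \<open>s < t\<close> show ?thesis by (simp add: flux_minus)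
  qed
qed

text \<open>
  At the origin the difference quotient has modulus \<open>\<bar>h\<bar> powr (p - 1)\<close>, which tends to zero because
  \<open>p > 1\<close>; on the negative half line the formula follows by reflection.
\<close>
lemma abs_powr_has_derivative:
  assumes "p > 1"
  shows "((\<lambda>s. \<bar>s\<bar> powr p) has_real_derivative p * flux p s) (at s)"
proof -
  have pos: "((\<lambda>s. \<bar>s\<bar> powr p) has_real_derivative p * flux p s) (at s)" if "s > 0" for s
  proof -
    have "((\<lambda>s. s powr p) has_real_derivative p * flux p s) (at s)"
      using that by (auto intro!: derivative_eq_intros simp: flux_pos)
    then show ?thesis
      by (rule has_field_derivative_transform_within_open[where S = "{0<..}"]) (use that in auto)
  qed
  consider "s > 0" | "s = 0" | "s < 0" by linarith
  then show ?thesis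
  proof cases
    case 3
    have "((\<lambda>s. \<bar>- s\<bar> powr p) has_real_derivative (p * flux p (- s)) * (- 1)) (at s)"
      by (rule DERIV_chain2[where f = "\<lambda>s. \<bar>s\<bar> powr p"])
         (use 3 in \<open>auto intro!: pos derivative_eq_intros\<close>)
    then show ?thesis by (simp add: flux_minus)
  next
    case 2
    have "((\<lambda>h::real. \<bar>h\<bar> powr (p - 1)) \<longlongrightarrow> \<bar>0\<bar> powr (p - 1)) (at 0)"
      using assms by (intro tendsto_powr' tendsto_rabs) auto
    then have "((\<lambda>h::real. \<bar>h\<bar> powr (p - 1)) \<longlongrightarrow> 0) (at 0)" by simp
    then have "((\<lambda>h::real. \<bar>h\<bar> powr p / h) \<longlongrightarrow> 0) (at 0)"
    proof (rule Lim_null_comparison[rotated])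
      have "norm (\<bar>h\<bar> powr p / h) \<le> \<bar>h\<bar> powr (p - 1)" if "h \<noteq> 0" for h :: real
        using that by (simp add: powr_diff)
      then show "\<forall>\<^sub>F h in at 0. norm (\<bar>h\<bar> powr p / h) \<le> \<bar>h\<bar> powr (p - 1)"
        by (auto simp: eventually_at_filter)
    qed
    then show ?thesis
      using 2 by (simp add: DERIV_def flux_def)
  qed (use pos in auto)
qed

text \<open>
  Strict convexity in the form of a tangent inequality: by the mean value theorem the increment
  is the derivative at an intermediate point, and the derivative is strictly increasing.
\<close>
lemma abs_powr_tangent_less:
  assumes "p > 1" "a \<noteq> s"
  shows "\<bar>s\<bar> powr p + p * flux p s * (a - s) < \<bar>a\<bar> powr p"
proof (cases "s < a")
  case True
  then obtain z where z: "s < z" "\<bar>a\<bar> powr p - \<bar>s\<bar> powr p = (a - s) * (p * flux p z)"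
    using MVT2[OF True, of "\<lambda>s. \<bar>s\<bar> powr p" "\<lambda>s. p * flux p s"] abs_powr_has_derivative[OF assms(1)]
    by blast
  have "(a - s) * (p * flux p s) < (a - s) * (p * flux p z)"
    using True assms(1) flux_strict_mono[OF assms(1) z(1)] by simp
  with z(2) show ?thesis by (simp add: algebra_simps)
next
  case False
  with assms have "a < s" by simp
  then obtain z where z: "z < s" "\<bar>s\<bar> powr p - \<bar>a\<bar> powr p = (s - a) * (p * flux p z)"
    using MVT2[of a s "\<lambda>s. \<bar>s\<bar> powr p" "\<lambda>s. p * flux p s"] abs_powr_has_derivative[OF assms(1)]
    by blast
  have "(s - a) * (p * flux p z) < (s - a) * (p * flux p s)"
    using \<open>a < s\<close> assms(1) flux_strict_mono[OF assms(1) z(1)] by simp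
  with z(2) show ?thesis by (simp add: algebra_simps)
qed

lemma abs_powr_tangent_le:
  assumes "p > 1"
  shows "\<bar>s\<bar> powr p + p * flux p s * (a - s) \<le> \<bar>a\<bar> powr p"
  using abs_powr_tangent_less[OF assms, of a s] by (cases "a = s") auto

lemma abs_powr_convex:
  fixes a b p t :: real
  assumes "p > 1" "0 \<le> t" "t \<le> 1"
  shows "\<bar>(1 - t) * a + t * b\<bar> powr p \<le> (1 - t) * \<bar>a\<bar> powr p + t * \<bar>b\<bar> powr p"
proof -
  define s where "s = (1 - t) * a + t * b"
  have "(1 - t) * (\<bar>s\<bar> powr p + p * flux p s * (a - s)) + t * (\<bar>s\<bar> powr p + p * flux p s * (b - s))
      \<le> (1 - t) * \<bar>a\<bar> powr p + t * \<bar>b\<bar> powr p"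
    using assms by (intro add_mono mult_left_mono abs_powr_tangent_le) auto
  also have "(1 - t) * (\<bar>s\<bar> powr p + p * flux p s * (a - s)) + t * (\<bar>s\<bar> powr p + p * flux p s * (b - s))
      = \<bar>s\<bar> powr p + p * flux p s * ((1 - t) * a + t * b - s)"
    by (simp add: algebra_simps)
  finally show ?thesis by (simp add: s_def)
qed

lemma abs_powr_midpoint_le:
  fixes a b p :: real
  assumes "p > 1"
  shows "\<bar>(a + b) / 2\<bar> powr p \<le> (\<bar>a\<bar> powr p + \<bar>b\<bar> powr p) / 2"
proof -
  have "\<bar>(1 - 1 / 2) * a + 1 / 2 * b\<bar> powr p \<le> (1 - 1 / 2) * \<bar>a\<bar> powr p + 1 / 2 * \<bar>b\<bar> powr p"
    using assms by (intro abs_powr_convex) auto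
  moreover have "(1 - 1 / 2) * a + 1 / 2 * b = (a + b) / 2" by simp
  ultimately show ?thesis by (simp only:) simp
qed

lemma abs_powr_midpoint_less:
  fixes a b p :: real
  assumes "p > 1" "a \<noteq> b"
  shows "\<bar>(a + b) / 2\<bar> powr p < (\<bar>a\<bar> powr p + \<bar>b\<bar> powr p) / 2"
proof -
  define s where "s = (a + b) / 2"
  have "a \<noteq> s" "b \<noteq> s" using assms by (auto simp: s_def field_simps)
  then have "\<bar>s\<bar> powr p + p * flux p s * (a - s) + (\<bar>s\<bar> powr p + p * flux p s * (b - s))
      < \<bar>a\<bar> powr p + \<bar>b\<bar> powr p"
    using assms by (intro add_strict_mono abs_powr_tangent_less) auto
  moreover have "p * flux p s * (a - s) + p * flux p s * (b - s) = 0"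
    unfolding distrib_left[symmetric] by (simp add: s_def)
  ultimately show ?thesis by (simp add: s_def)
qed

lemma abs_add_powr_le:
  fixes a b p :: real
  assumes "p > 1"
  shows "\<bar>a + b\<bar> powr p \<le> 2 powr p * (\<bar>a\<bar> powr p + \<bar>b\<bar> powr p)"
proof -
  have "\<bar>a + b\<bar> powr p = 2 powr p * \<bar>(a + b) / 2\<bar> powr p"
    by (subst powr_mult[symmetric]) auto
  also have "\<dots> \<le> 2 powr p * ((\<bar>a\<bar> powr p + \<bar>b\<bar> powr p) / 2)"
    by (intro mult_left_mono abs_powr_midpoint_le assms) auto
  also have "\<dots> \<le> 2 powr p * (\<bar>a\<bar> powr p + \<bar>b\<bar> powr p)"
    by (intro mult_left_mono) auto
  finally show ?thesis .
qed

lemma abs_diff_powr_le: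
  fixes a b p :: real
  assumes "p > 1"
  shows "\<bar>a - b\<bar> powr p \<le> 2 powr p * (\<bar>a\<bar> powr p + \<bar>b\<bar> powr p)"
  using abs_add_powr_le[OF assms, of a "- b"] by simp

text \<open>
  Jensen's inequality for \<open>a + b = (1 - t) (a / (1 - t)) + t (b / t)\<close>. As \<open>t\<close> tends to zero, the
  coefficient of \<open>\<bar>a\<bar> powr p\<close> tends to one, so the estimate absorbs a perturbation \<open>b\<close> of small energy.
\<close>
lemma abs_add_powr_perturb:
  fixes a b p t :: real
  assumes "p > 1" "0 < t" "t < 1"
  shows "\<bar>a + b\<bar> powr p \<le> (1 - t) powr (1 - p) * \<bar>a\<bar> powr p + t powr (1 - p) * \<bar>b\<bar> powr p"
proof -
  have scale: "c * \<bar>x / c\<bar> powr p = c powr (1 - p) * \<bar>x\<bar> powr p" if "c > 0" for c x :: real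
    using that by (simp add: powr_divide powr_diff)
  have "\<bar>a + b\<bar> powr p = \<bar>(1 - t) * (a / (1 - t)) + t * (b / t)\<bar> powr p"
    using assms by simp
  also have "\<dots> \<le> (1 - t) * \<bar>a / (1 - t)\<bar> powr p + t * \<bar>b / t\<bar> powr p"
    using assms by (intro abs_powr_convex) auto
  finally show ?thesis using assms by (simp only: scale)
qed

text \<open>
  A weak form of Young's inequality whose proof is a comparison of \<open>b\<close> with \<open>\<eta> * a\<close>. It replaces
  Hoelder's inequality below.
\<close>
lemma young_le:
  fixes a b :: real
  assumes "p > 1" "\<eta> > 0" "a \<ge> 0" "b \<ge> 0"
  shows "a powr (p - 1) * b \<le> \<eta> * a powr p + \<eta> powr (1 - p) * b powr p"
proof (cases "a = 0")
  case False
  with assms have "a > 0" by simp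
  show ?thesis
  proof (cases "b \<le> \<eta> * a")
    case True
    have "a powr (p - 1) * b \<le> a powr (p - 1) * (\<eta> * a)"
      using True by (intro mult_left_mono) auto
    also have "\<dots> = \<eta> * a powr p"
      using \<open>a > 0\<close> by (simp add: powr_diff)
    finally show ?thesis by (simp add: add_increasing2)
  next
    case False
    then have "a \<le> b / \<eta>" "b > 0"
      using assms \<open>a > 0\<close> by (auto simp: field_simps) (smt (verit) mult_pos_pos)
    then have "a powr (p - 1) * b \<le> (b / \<eta>) powr (p - 1) * b"
      using assms \<open>a > 0\<close> by (intro mult_right_mono powr_mono2) auto
    also have "\<dots> = \<eta> powr (1 - p) * b powr p"
      using assms \<open>b > 0\<close> by (simp add: powr_divide powr_diff)
    finally show ?thesis using assms by (simp add: add_increasing)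
  qed
qed (use assms in auto)

text \<open>
  Uniform convexity with one proof for all \<open>p > 1\<close>, in place of Clarkson's inequalities. Both
  sides are homogeneous, so one may assume \<open>\<bar>a\<bar> powr p + \<bar>b\<bar> powr p = 1\<close>. If
  \<open>\<bar>a - b\<bar> powr p\<close> is below \<open>\<eta>\<close> there is nothing to do; the remaining pairs form a compact set
  on which the gap in the midpoint inequality is continuous and, by strict convexity, positive,
  hence bounded below.
\<close>
lemma abs_powr_uniformly_convex:
  fixes p \<eta> :: real
  assumes p: "p > 1" and \<eta>: "\<eta> > 0"
  obtains C :: real where "C > 0"
    and "\<And>a b :: real. \<bar>a - b\<bar> powr p
          \<le> \<eta> * (\<bar>a\<bar> powr p + \<bar>b\<bar> powr p)
            + C * ((\<bar>a\<bar> powr p + \<bar>b\<bar> powr p) / 2 - \<bar>(a + b) / 2\<bar> powr p)"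
proof -
  define N where "N = (\<lambda>z :: real \<times> real. \<bar>fst z\<bar> powr p + \<bar>snd z\<bar> powr p :: real)"
  define G where "G = (\<lambda>z :: real \<times> real. N z / 2 - \<bar>(fst z + snd z) / 2\<bar> powr p)"
  define S where "S = {z \<in> {-1..1} \<times> {-1..1}. N z = 1 \<and> \<bar>fst z - snd z\<bar> powr p \<ge> \<eta>}"
  have cont: "continuous_on A (\<lambda>z. \<bar>f z\<bar> powr p)" if "continuous_on A f" for A and f :: "real \<times> real \<Rightarrow> real"
    using that p by (intro continuous_on_powr' continuous_intros) auto
  have contN: "continuous_on A N" for A
    unfolding N_def by (intro continuous_intros cont)
  have contG: "continuous_on A G" for A
    unfolding G_def by (intro continuous_intros cont contN) auto
  have "closed {z. N z = 1}"
    by (intro closed_Collect_eq contN continuous_intros)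
  moreover have "closed {z::real \<times> real. \<eta> \<le> \<bar>fst z - snd z\<bar> powr p}"
    by (intro closed_Collect_le continuous_intros cont)
  moreover have "S = ({-1..1} \<times> {-1..1}) \<inter> ({z. N z = 1} \<inter> {z. \<eta> \<le> \<bar>fst z - snd z\<bar> powr p})"
    by (auto simp: S_def)
  ultimately have "compact S"
    by (auto intro!: compact_Int_closed compact_Times)
  have Gpos: "G z > 0" if "z \<in> S" for z
  proof -
    have "fst z \<noteq> snd z" using that \<eta> by (auto simp: S_def)
    then show ?thesis using abs_powr_midpoint_less[OF p] by (simp add: G_def N_def)
  qed
  obtain \<delta> where "\<delta> > 0" and \<delta>: "\<And>z. z \<in> S \<Longrightarrow> \<delta> \<le> G z"
  proof (cases "S = {}")
    case True
    then show ?thesis using that[of 1] by auto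
  next
    case False
    then obtain z where "z \<in> S" "\<And>y. y \<in> S \<Longrightarrow> G z \<le> G y"
      using continuous_attains_inf[OF \<open>compact S\<close> _ contG] by blast
    then show ?thesis using that Gpos by blast
  qed
  define C where "C = 2 powr p / \<delta>"
  have main: "\<bar>a - b\<bar> powr p \<le> \<eta> * N (a, b) + C * G (a, b)" for a b
  proof (cases "N (a, b) = 0")
    case True
    then have "a = 0" "b = 0" by (auto simp: N_def add_nonneg_eq_0_iff)
    then show ?thesis by (simp add: N_def G_def)
  next
    case False
    define r where "r = N (a, b) powr (1 / p)"
    have Npos: "N (a, b) > 0" using False by (simp add: N_def less_le)
    then have "r > 0" and rp: "r powr p = N (a, b)"
      using p by (auto simp: r_def powr_powr)
    define u v where "u = a / r" and "v = b / r"
    have scale: "\<bar>x / r\<bar> powr p = \<bar>x\<bar> powr p / N (a, b)" for x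
      using \<open>r > 0\<close> rp by (simp add: powr_divide)
    have N1: "N (u, v) = 1"
    proof -
      have "N (u, v) = \<bar>a\<bar> powr p / N (a, b) + \<bar>b\<bar> powr p / N (a, b)"
        unfolding u_def v_def scale[symmetric] by (simp add: N_def)
      also have "\<dots> = N (a, b) / N (a, b)"
        unfolding add_divide_distrib[symmetric] by (simp add: N_def)
      finally show ?thesis using Npos by simp
    qed
    have Guv: "G (u, v) = G (a, b) / N (a, b)"
    proof -
      have "\<bar>(u + v) / 2\<bar> powr p = \<bar>((a + b) / 2) / r\<bar> powr p"
        by (simp add: u_def v_def add_divide_distrib mult.commute)
      also have "\<dots> = \<bar>(a + b) / 2\<bar> powr p / N (a, b)" by (rule scale)
      finally have "G (u, v) = 1 / 2 - \<bar>(a + b) / 2\<bar> powr p / N (a, b)" using N1 by (simp add: G_def)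
      also have "\<dots> = G (a, b) / N (a, b)" using Npos by (simp add: G_def diff_divide_distrib)
      finally show ?thesis .
    qed
    have Guv0: "G (u, v) \<ge> 0"
      using abs_powr_midpoint_le[OF p, of u v] by (simp add: G_def N_def)
    have "C > 0" using \<open>\<delta> > 0\<close> by (simp add: C_def)
    have "\<bar>u - v\<bar> powr p \<le> \<eta> + C * G (u, v)"
    proof (cases "\<eta> \<le> \<bar>u - v\<bar> powr p")
      case True
      have le1: "\<bar>x\<bar> \<le> 1" if "\<bar>x\<bar> powr p \<le> 1" for x :: real
      proof (rule ccontr)
        assume "\<not> \<bar>x\<bar> \<le> 1"
        then have "1 powr p < \<bar>x\<bar> powr p" using p by (intro powr_less_mono2) auto
        with that show False by simp
      qed
      have "\<bar>u\<bar> powr p \<le> N (u, v)" "\<bar>v\<bar> powr p \<le> N (u, v)" by (simp_all add: N_def)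
      then have "\<bar>u\<bar> \<le> 1" "\<bar>v\<bar> \<le> 1" unfolding N1 by (auto intro: le1)
      then have "(u, v) \<in> S" using True N1 by (auto simp: S_def)
      have "\<bar>u - v\<bar> powr p \<le> 2 powr p * N (u, v)"
        using abs_diff_powr_le[OF p] by (simp add: N_def)
      also have "\<dots> = C * \<delta>" using N1 \<open>\<delta> > 0\<close> by (simp add: C_def)
      also have "\<dots> \<le> C * G (u, v)"
        using \<delta>[OF \<open>(u, v) \<in> S\<close>] \<open>C > 0\<close> by simp
      finally show ?thesis using \<eta> by simp
    next
      case False
      then show ?thesis using Guv0 \<open>C > 0\<close> by (simp add: add_increasing2)
    qed
    moreover have "\<bar>u - v\<bar> powr p = \<bar>a - b\<bar> powr p / N (a, b)"
      using scale[of "a - b"] by (simp add: u_def v_def diff_divide_distrib)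
    ultimately show ?thesis
      using Npos Guv by (simp add: field_simps)
  qed
  show thesis
  proof (rule that[of C])
    show "C > 0" using \<open>\<delta> > 0\<close> by (simp add: C_def)
  qed (use main in \<open>simp add: N_def G_def\<close>)
qed

section \<open>Finite energy\<close>

definition clamp :: "real \<Rightarrow> real \<Rightarrow> real" where
  "clamp M t = max (- M) (min M t)"

lemma clamp_contraction: "\<bar>clamp M a - clamp M b\<bar> \<le> \<bar>a - b\<bar>"
  by (auto simp: clamp_def max_def min_def)

lemma diff_clamp_contraction: "\<bar>(a - clamp M a) - (b - clamp M b)\<bar> \<le> \<bar>a - b\<bar>"
  by (auto simp: clamp_def max_def min_def)

lemma abs_clamp_le: "M \<ge> 0 \<Longrightarrow> \<bar>clamp M t\<bar> \<le> M"
  by (auto simp: clamp_def)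

lemma clamp_eq: "\<bar>t\<bar> \<le> M \<Longrightarrow> clamp M t = t"
  by (auto simp: clamp_def)

lemma clamp_0: "M \<ge> 0 \<Longrightarrow> clamp M 0 = 0"
  by (auto simp: clamp_def)

lemma tendsto_clamp: "(g \<longlongrightarrow> l) F \<Longrightarrow> ((\<lambda>x. clamp M (g x)) \<longlongrightarrow> clamp M l) F"
  unfolding clamp_def by (intro tendsto_intros)

definition grad :: "('v \<Rightarrow> real) \<Rightarrow> 'v \<times> 'v \<Rightarrow> real" where
  "grad f e = f (snd e) - f (fst e)"

lemma nn_integral_count_space_eq_infsum:
  fixes f :: "'a \<Rightarrow> ennreal"
  assumes "countable A" "infinite A"
  shows "(\<integral>\<^sup>+x. f x \<partial>count_space A) = infsum f A"
proof -
  note bij = bij_betw_from_nat_into[OF assms]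
  have "(\<lambda>n. f (from_nat_into A n)) sums infsum (\<lambda>n. f (from_nat_into A n)) UNIV"
    by (intro has_sum_imp_sums has_sum_infsum nonneg_summable_on_complete) simp
  then have "(\<Sum>n. f (from_nat_into A n)) = infsum f A"
    by (simp add: sums_iff infsum_reindex_bij_betw[OF bij])
  then show ?thesis
    by (simp add: nn_integral_bij_count_space[OF bij, symmetric] nn_integral_count_space_nat)
qed

locale dirichlet_graph =
  fixes E :: "'v \<Rightarrow> 'v \<Rightarrow> bool" and p :: real and o' :: 'v
  assumes p_gt_1: "p > 1"
    and countable_UNIV: "countable (UNIV :: 'v set)" and infinite_UNIV: "infinite (UNIV :: 'v set)"
    and symp_E: "symp E" and irreflp_E: "irreflp E"
    and connected_E: "connected_graph E" and bounded_degree_E: "bounded_degree E"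
begin

definition edges :: "('v \<times> 'v) set" where
  "edges = {(x, y). E x y}"

definition dirichlet :: "('v \<Rightarrow> real) \<Rightarrow> bool" where
  "dirichlet f \<longleftrightarrow> integrable (count_space edges) (\<lambda>e. \<bar>grad f e\<bar> powr p)"

definition energy :: "('v \<Rightarrow> real) \<Rightarrow> real" where
  "energy f = (\<integral>e. \<bar>grad f e\<bar> powr p \<partial>count_space edges)"

lemma finite_nbrs: "finite (nbrs E x)"
  using bounded_degree_E by (auto simp: bounded_degree_def)

lemma p_energy_eq_nn_integral:
  "p_energy E p f = (\<integral>\<^sup>+e. ennreal (\<bar>grad f e\<bar> powr p) \<partial>count_space edges)"
proof -
  have "p_energy E p f = (\<integral>\<^sup>+x. (\<Sum>y\<in>nbrs E x. ennreal (\<bar>f y - f x\<bar> powr p)) \<partial>count_space UNIV)"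
    by (simp add: p_energy_def nn_integral_count_space_eq_infsum[OF countable_UNIV infinite_UNIV])
  also have "\<dots> = (\<integral>\<^sup>+x. \<integral>\<^sup>+y. ennreal (\<bar>grad f (x, y)\<bar> powr p) * indicator edges (x, y)
                    \<partial>count_space UNIV \<partial>count_space UNIV)"
  proof (intro nn_integral_cong)
    fix x
    have "(\<Sum>y\<in>nbrs E x. ennreal (\<bar>f y - f x\<bar> powr p))
        = (\<Sum>y\<in>nbrs E x. ennreal (\<bar>grad f (x, y)\<bar> powr p) * indicator edges (x, y))"
      by (intro sum.cong) (auto simp: nbrs_def edges_def grad_def)
    also have "\<dots> = (\<integral>\<^sup>+y. ennreal (\<bar>grad f (x, y)\<bar> powr p) * indicator edges (x, y) \<partial>count_space UNIV)"
      by (intro nn_integral_count_space'[symmetric] finite_nbrs) (auto simp: nbrs_def edges_def)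
    finally show "(\<Sum>y\<in>nbrs E x. ennreal (\<bar>f y - f x\<bar> powr p))
        = (\<integral>\<^sup>+y. ennreal (\<bar>grad f (x, y)\<bar> powr p) * indicator edges (x, y) \<partial>count_space UNIV)" .
  qed
  also have "\<dots> = (\<integral>\<^sup>+e. ennreal (\<bar>grad f e\<bar> powr p) * indicator edges e \<partial>count_space UNIV)"
    by (rule nn_integral_fst_count_space)
  also have "\<dots> = (\<integral>\<^sup>+e. ennreal (\<bar>grad f e\<bar> powr p) \<partial>count_space edges)"
    by (cases "edges = UNIV") (simp_all add: nn_integral_count_space_indicator)
  finally show ?thesis .
qed

lemma D_space_iff_dirichlet: "f \<in> D_space E p \<longleftrightarrow> dirichlet f"
  by (simp add: D_space_def p_energy_eq_nn_integral dirichlet_def integrable_iff_bounded)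

lemma p_energy_eq_energy: "dirichlet f \<Longrightarrow> p_energy E p f = ennreal (energy f)"
  unfolding p_energy_eq_nn_integral dirichlet_def energy_def
  by (rule nn_integral_eq_integral) auto

lemma energy_nonneg: "energy f \<ge> 0"
  by (simp add: energy_def)

lemma dirichlet_bound:
  assumes "integrable (count_space edges) h" "\<And>e. e \<in> edges \<Longrightarrow> \<bar>grad f e\<bar> powr p \<le> h e"
  shows "dirichlet f" and "energy f \<le> (\<integral>e. h e \<partial>count_space edges)"
proof -
  show D: "dirichlet f"
    unfolding dirichlet_def using assms
    by (intro Bochner_Integration.integrable_bound[OF assms(1)] AE_I2) (auto intro: order_trans[OF _ abs_ge_self])
  show "energy f \<le> (\<integral>e. h e \<partial>count_space edges)"
    unfolding energy_def using D assms by (intro integral_mono) (auto simp: dirichlet_def)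
qed

lemma dirichlet_contraction:
  assumes "dirichlet f" "\<And>x y. \<bar>g y - g x\<bar> \<le> \<bar>f y - f x\<bar>"
  shows "dirichlet g" and "energy g \<le> energy f"
proof -
  have le: "\<bar>grad g e\<bar> powr p \<le> \<bar>grad f e\<bar> powr p" for e
    using assms(2) p_gt_1 by (auto simp: grad_def intro!: powr_mono2)
  note int = assms(1)[unfolded dirichlet_def]
  show "dirichlet g" by (rule dirichlet_bound(1)[OF int le])
  show "energy g \<le> energy f" using dirichlet_bound(2)[OF int le] by (simp add: energy_def)
qed

lemma dirichlet_add:
  assumes "dirichlet f" "dirichlet g"
  shows "dirichlet (\<lambda>x. f x + g x)"
    and "energy (\<lambda>x. f x + g x) \<le> 2 powr p * (energy f + energy g)"
proof -
  have int: "integrable (count_space edges) (\<lambda>e. 2 powr p * (\<bar>grad f e\<bar> powr p + \<bar>grad g e\<bar> powr p))"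
    using assms by (auto simp: dirichlet_def)
  have le: "\<bar>grad (\<lambda>x. f x + g x) e\<bar> powr p \<le> 2 powr p * (\<bar>grad f e\<bar> powr p + \<bar>grad g e\<bar> powr p)" for e
    using abs_add_powr_le[OF p_gt_1, of "grad f e" "grad g e"] by (simp add: grad_def algebra_simps)
  show "dirichlet (\<lambda>x. f x + g x)"
    by (rule dirichlet_bound(1)[OF int le])
  show "energy (\<lambda>x. f x + g x) \<le> 2 powr p * (energy f + energy g)"
    using dirichlet_bound(2)[OF int le] assms by (simp add: energy_def dirichlet_def)
qed

lemma dirichlet_cmult:
  assumes "dirichlet f"
  shows "dirichlet (\<lambda>x. c * f x)" and "energy (\<lambda>x. c * f x) = \<bar>c\<bar> powr p * energy f"
proof -
  have eq: "\<bar>grad (\<lambda>x. c * f x) e\<bar> powr p = \<bar>c\<bar> powr p * \<bar>grad f e\<bar> powr p" for e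
    by (simp add: grad_def right_diff_distrib[symmetric] abs_mult powr_mult)
  show "dirichlet (\<lambda>x. c * f x)" using assms by (simp add: dirichlet_def eq)
  show "energy (\<lambda>x. c * f x) = \<bar>c\<bar> powr p * energy f" by (simp add: energy_def eq)
qed

lemma dirichlet_diff:
  assumes "dirichlet f" "dirichlet g"
  shows "dirichlet (\<lambda>x. f x - g x)"
    and "energy (\<lambda>x. f x - g x) \<le> 2 powr p * (energy f + energy g)"
  using dirichlet_add[OF assms(1) dirichlet_cmult(1)[OF assms(2), of "-1"]]
    dirichlet_cmult(2)[OF assms(2), of "-1"] by simp_all

lemma energy_diff_commute: "energy (\<lambda>x. f x - g x) = energy (\<lambda>x. g x - f x)"
proof -
  have "\<bar>grad (\<lambda>x. f x - g x) e\<bar> = \<bar>grad (\<lambda>x. g x - f x) e\<bar>" for e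
    unfolding grad_def by linarith
  then show ?thesis by (simp add: energy_def)
qed

lemma dirichlet_const: "dirichlet (\<lambda>x. c)"
  by (simp add: dirichlet_def grad_def)

lemma dirichlet_midpoint:
  assumes "dirichlet f" "dirichlet g"
  shows "dirichlet (\<lambda>x. (f x + g x) / 2)"
  using dirichlet_cmult(1)[OF dirichlet_add(1)[OF assms], of "1/2"] by simp

lemma finite_edges_touching: "finite S \<Longrightarrow> finite {e \<in> edges. fst e \<in> S \<or> snd e \<in> S}"
proof -
  assume "finite S"
  then have "finite (Sigma S (nbrs E) \<union> prod.swap ` Sigma S (nbrs E))"
    by (auto intro: finite_nbrs)
  moreover have "{e \<in> edges. fst e \<in> S \<or> snd e \<in> S} \<subseteq> Sigma S (nbrs E) \<union> prod.swap ` Sigma S (nbrs E)"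
    using symp_E by (auto simp: edges_def nbrs_def symp_def image_iff)
  ultimately show ?thesis by (rule finite_subset[rotated])
qed

lemma integrable_edges_finite_support:
  fixes h :: "'v \<times> 'v \<Rightarrow> real"
  assumes "finite {e \<in> edges. h e \<noteq> 0}"
  shows "integrable (count_space edges) h"
proof -
  have "(\<integral>\<^sup>+e. ennreal (norm (h e)) \<partial>count_space edges) = (\<Sum>e\<in>{e \<in> edges. h e \<noteq> 0}. ennreal (norm (h e)))"
    by (rule nn_integral_count_space'[OF assms]) auto
  then show ?thesis by (auto simp: integrable_iff_bounded)
qed

lemma finitely_supported_dirichlet:
  assumes "g \<in> finitely_supported"
  shows "dirichlet g"
  unfolding dirichlet_def
proof (rule integrable_edges_finite_support)
  have "finite {e \<in> edges. fst e \<in> {x. g x \<noteq> 0} \<or> snd e \<in> {x. g x \<noteq> 0}}"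
    using assms by (intro finite_edges_touching) (simp add: finitely_supported_def)
  then show "finite {e \<in> edges. \<bar>grad g e\<bar> powr p \<noteq> 0}"
    by (rule finite_subset[rotated]) (auto simp: grad_def)
qed

lemma grad_powr_le_energy:
  assumes "dirichlet f" "E x y"
  shows "\<bar>f y - f x\<bar> powr p \<le> energy f"
proof -
  have e: "(x, y) \<in> edges" using assms by (simp add: edges_def)
  have "ennreal (\<bar>grad f (x, y)\<bar> powr p) \<le> (\<integral>\<^sup>+e. ennreal (\<bar>grad f e\<bar> powr p) \<partial>count_space edges)"
    by (rule nn_integral_ge_point[OF e])
  also have "\<dots> = ennreal (energy f)"
    using p_energy_eq_energy[OF assms(1)] by (simp add: p_energy_eq_nn_integral)
  finally show ?thesis by (simp add: grad_def energy_nonneg)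
qed

lemma dirichlet_Fatou:
  assumes D: "\<And>n. dirichlet (w n)" and lim: "\<And>x. (\<lambda>n. w n x) \<longlonglongrightarrow> v x"
    and K: "\<forall>\<^sub>F n in sequentially. energy (w n) \<le> K"
  shows "dirichlet v" and "energy v \<le> K"
proof -
  have "(\<integral>\<^sup>+e. ennreal (\<bar>grad v e\<bar> powr p) \<partial>count_space edges)
      = (\<integral>\<^sup>+e. liminf (\<lambda>n. ennreal (\<bar>grad (w n) e\<bar> powr p)) \<partial>count_space edges)"
  proof (intro nn_integral_cong lim_imp_Liminf[symmetric] sequentially_bot tendsto_ennrealI)
    show "(\<lambda>n. \<bar>grad (w n) e\<bar> powr p) \<longlonglongrightarrow> \<bar>grad v e\<bar> powr p" for e
      unfolding grad_def using p_gt_1 by (intro tendsto_powr' tendsto_intros lim) auto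
  qed
  also have "\<dots> \<le> liminf (\<lambda>n. \<integral>\<^sup>+e. ennreal (\<bar>grad (w n) e\<bar> powr p) \<partial>count_space edges)"
    by (rule nn_integral_liminf) simp
  also have "\<dots> = liminf (\<lambda>n. ennreal (energy (w n)))"
    using p_energy_eq_energy[OF D] by (simp add: p_energy_eq_nn_integral)
  also have "\<dots> \<le> limsup (\<lambda>n. ennreal (energy (w n)))"
    by (rule Liminf_le_Limsup) simp
  also have "\<dots> \<le> ennreal K"
    by (rule Limsup_bounded) (use K in \<open>auto elim!: eventually_mono intro: ennreal_leI\<close>)
  finally have le: "(\<integral>\<^sup>+e. ennreal (\<bar>grad v e\<bar> powr p) \<partial>count_space edges) \<le> ennreal K" .
  then show Dv: "dirichlet v"
    by (auto simp: dirichlet_def integrable_iff_bounded intro: le_less_trans)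
  obtain n where "energy (w n) \<le> K"
    using K by (auto simp: eventually_sequentially)
  then have "K \<ge> 0" using energy_nonneg[of "w n"] by linarith
  then show "energy v \<le> K"
    using le p_energy_eq_energy[OF Dv] by (simp add: p_energy_eq_nn_integral)
qed

text \<open>
  The energy controls the difference across every edge, so convergence at one vertex propagates
  along paths.
\<close>
lemma tendsto_of_energy_tendsto:
  assumes D: "\<And>n. dirichlet (w n)" and lim: "(\<lambda>n. energy (w n)) \<longlonglongrightarrow> 0"
    and a: "(\<lambda>n. w n a) \<longlonglongrightarrow> 0"
  shows "(\<lambda>n. w n x) \<longlonglongrightarrow> 0"
proof -
  have edge_lim: "(\<lambda>n. w n z - w n y) \<longlonglongrightarrow> 0" if "E y z" for y z
  proof -
    have "(\<lambda>n. energy (w n) powr (1 / p)) \<longlonglongrightarrow> 0 powr (1 / p)"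
      using p_gt_1 lim by (intro tendsto_powr') (auto simp: energy_nonneg)
    then have root: "(\<lambda>n. energy (w n) powr (1 / p)) \<longlonglongrightarrow> 0" by simp
    have "norm (w n z - w n y) \<le> energy (w n) powr (1 / p)" for n
    proof -
      have "(\<bar>w n z - w n y\<bar> powr p) powr (1 / p) \<le> energy (w n) powr (1 / p)"
        using grad_powr_le_energy[OF D that] p_gt_1 by (intro powr_mono2) auto
      then show ?thesis using p_gt_1 by (simp add: powr_powr)
    qed
    then show ?thesis by (rule Lim_null_comparison[OF always_eventually[OF allI] root])
  qed
  have "E\<^sup>*\<^sup>* a x" using connected_E by (simp add: connected_graph_def)
  then show ?thesis
  proof induction
    case (step y z)
    from tendsto_add[OF step.IH edge_lim[OF step.hyps(2)]] show ?case by simp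
  qed (rule a)
qed

section \<open>The derivative of the energy\<close>

text \<open>
  Up to the factor \<open>p\<close>, the derivative of the energy at \<open>h\<close> in the direction \<open>u\<close>: the weak form of
  the \<open>p\<close>-Laplacian.
\<close>
definition pairing :: "('v \<Rightarrow> real) \<Rightarrow> ('v \<Rightarrow> real) \<Rightarrow> real" where
  "pairing h u = (\<integral>e. flux p (grad h e) * grad u e \<partial>count_space edges)"

lemma abs_flux_mult_le:
  assumes "\<eta> > 0"
  shows "\<bar>flux p a * b\<bar> \<le> \<eta> * \<bar>a\<bar> powr p + \<eta> powr (1 - p) * \<bar>b\<bar> powr p"
  using young_le[OF p_gt_1 assms, of "\<bar>a\<bar>" "\<bar>b\<bar>"] by (simp add: abs_mult abs_flux)

lemma integrable_pairing:
  assumes "dirichlet h" "dirichlet u"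
  shows "integrable (count_space edges) (\<lambda>e. flux p (grad h e) * grad u e)"
proof (rule Bochner_Integration.integrable_bound)
  show "integrable (count_space edges) (\<lambda>e. 1 * \<bar>grad h e\<bar> powr p + 1 powr (1 - p) * \<bar>grad u e\<bar> powr p)"
    using assms by (auto simp: dirichlet_def)
  show "AE e in count_space edges. norm (flux p (grad h e) * grad u e)
      \<le> norm (1 * \<bar>grad h e\<bar> powr p + 1 powr (1 - p) * \<bar>grad u e\<bar> powr p)"
    using abs_flux_mult_le[of 1]
    by (intro AE_I2) (auto intro: order_trans[OF _ abs_ge_self])
qed simp

lemma abs_pairing_le:
  assumes "dirichlet h" "dirichlet u" "\<eta> > 0"
  shows "\<bar>pairing h u\<bar> \<le> \<eta> * energy h + \<eta> powr (1 - p) * energy u"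
proof -
  have "\<bar>pairing h u\<bar> \<le> (\<integral>e. \<bar>flux p (grad h e) * grad u e\<bar> \<partial>count_space edges)"
    unfolding pairing_def by (rule integral_abs_bound)
  also have "\<dots> \<le> (\<integral>e. \<eta> * \<bar>grad h e\<bar> powr p + \<eta> powr (1 - p) * \<bar>grad u e\<bar> powr p \<partial>count_space edges)"
    using assms integrable_pairing[OF assms(1,2)]
    by (intro integral_mono abs_flux_mult_le integrable_abs) (auto simp: dirichlet_def)
  also have "\<dots> = \<eta> * energy h + \<eta> powr (1 - p) * energy u"
    using assms by (simp add: dirichlet_def energy_def)
  finally show ?thesis .
qed

lemma pairing_add:
  assumes "dirichlet h" "dirichlet u" "dirichlet v"
  shows "pairing h (\<lambda>x. u x + v x) = pairing h u + pairing h v"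
proof -
  have "flux p (grad h e) * grad (\<lambda>x. u x + v x) e
      = flux p (grad h e) * grad u e + flux p (grad h e) * grad v e" for e
    by (simp add: grad_def algebra_simps)
  then show ?thesis
    unfolding pairing_def using assms by (simp add: integrable_pairing)
qed

lemma pairing_add_const: "pairing h (\<lambda>x. u x + c) = pairing h u"
  by (simp add: pairing_def grad_def)

text \<open>
  Every undirected edge at \<open>x\<close> occurs twice in \<open>edges\<close>, once in each orientation, and there are
  no loops at \<open>x\<close> that would be counted only once.
\<close>
lemma integral_edges_at_vertex:
  assumes sym: "\<And>y z. w (y, z) = w (z, y)"
    and zero: "\<And>y z. y \<noteq> x \<Longrightarrow> z \<noteq> x \<Longrightarrow> w (y, z) = (0::real)"
  shows "(\<integral>e. w e \<partial>count_space edges) = 2 * (\<Sum>y\<in>nbrs E x. w (x, y))"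
proof -
  define out inn where "out = Pair x ` nbrs E x" and "inn = (\<lambda>y. (y, x)) ` nbrs E x"
  have symE: "E y z \<longleftrightarrow> E z y" for y z using symp_E by (auto simp: symp_def)
  have fin: "finite out" "finite inn" by (auto simp: out_def inn_def finite_nbrs)
  have disj: "out \<inter> inn = {}" using irreflp_E by (auto simp: out_def inn_def nbrs_def irreflp_def)
  have sub: "out \<union> inn \<subseteq> edges" using symE by (auto simp: out_def inn_def nbrs_def edges_def)
  have supp: "{e \<in> edges. w e \<noteq> 0} \<subseteq> out \<union> inn"
  proof
    fix e assume e: "e \<in> {e \<in> edges. w e \<noteq> 0}"
    obtain y z where yz: "e = (y, z)" by (cases e)
    with e zero have "y = x \<or> z = x" by auto
    then show "e \<in> out \<union> inn"
      using e yz symE by (auto simp: out_def inn_def nbrs_def edges_def)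
  qed
  have "(\<integral>e. w e \<partial>count_space edges) = (\<Sum>e | e \<in> edges \<and> w e \<noteq> 0. w e)"
    using supp fin by (intro lebesgue_integral_count_space_finite_support) (auto intro: finite_subset)
  also have "\<dots> = (\<Sum>e\<in>out \<union> inn. w e)"
    using supp fin sub by (intro sum.mono_neutral_left) auto
  also have "\<dots> = (\<Sum>e\<in>out. w e) + (\<Sum>e\<in>inn. w e)"
    by (rule sum.union_disjoint) (use fin disj in auto)
  also have "(\<Sum>e\<in>out. w e) = (\<Sum>y\<in>nbrs E x. w (x, y))"
    unfolding out_def by (subst sum.reindex) (auto simp: inj_on_def)
  also have "(\<Sum>e\<in>inn. w e) = (\<Sum>y\<in>nbrs E x. w (x, y))"
    unfolding inn_def by (subst sum.reindex) (auto simp: inj_on_def sym intro: sum.cong)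
  finally show ?thesis by simp
qed

lemma pairing_indicator:
  "pairing h (indicator {x}) = - 2 * p_laplacian E p h x"
proof -
  have "pairing h (indicator {x})
      = 2 * (\<Sum>y\<in>nbrs E x. flux p (grad h (x, y)) * grad (indicator {x}) (x, y))"
    unfolding pairing_def
  proof (rule integral_edges_at_vertex)
    fix y z
    have "flux p (grad h (y, z)) = - flux p (grad h (z, y))"
      by (subst flux_minus[symmetric]) (simp add: grad_def)
    then show "flux p (grad h (y, z)) * grad (indicator {x}) (y, z)
        = flux p (grad h (z, y)) * grad (indicator {x}) (z, y)"
      by (simp add: grad_def algebra_simps)
  qed (simp add: grad_def)
  also have "(\<Sum>y\<in>nbrs E x. flux p (grad h (x, y)) * grad (indicator {x}) (x, y))
      = (\<Sum>y\<in>nbrs E x. - flux p (h y - h x))"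
    using irreflp_E
    by (intro sum.cong) (auto simp: grad_def nbrs_def irreflp_def indicator_def)
  also have "\<dots> = - p_laplacian E p h x"
    by (simp add: p_laplacian_def flux_def sum_negf)
  finally show ?thesis by simp
qed

text \<open>
  Summation by parts: a finitely supported function is a linear combination of indicators of
  vertices, and pairing with the indicator of \<open>x\<close> yields a multiple of the \<open>p\<close>-Laplacian at \<open>x\<close>.
\<close>
lemma pairing_finitely_supported:
  assumes h: "dirichlet h" "p_harmonic E p h" and g: "g \<in> finitely_supported"
  shows "pairing h g = 0"
proof -
  define S where "S = {x. g x \<noteq> 0}"
  have fin: "finite S" using g by (simp add: S_def finitely_supported_def)
  have dir: "dirichlet (indicator {x})" for x
    by (rule finitely_supported_dirichlet) (simp add: finitely_supported_def indicator_def)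
  have gS: "g y = (\<Sum>x\<in>S. g x * indicator {x} y)" for y
    using fin by (cases "y \<in> S") (auto simp: S_def indicator_def if_distrib sum.delta cong: if_cong)
  have grad: "grad g e = (\<Sum>x\<in>S. g x * grad (indicator {x}) e)" for e
  proof -
    have "grad g e = (\<Sum>x\<in>S. g x * indicator {x} (snd e)) - (\<Sum>x\<in>S. g x * indicator {x} (fst e))"
      unfolding grad_def by (subst (1 2) gS) (rule refl)
    also have "\<dots> = (\<Sum>x\<in>S. g x * grad (indicator {x}) e)"
      by (simp add: sum_subtractf[symmetric] right_diff_distrib grad_def)
    finally show ?thesis .
  qed
  have "pairing h g = (\<integral>e. (\<Sum>x\<in>S. g x * (flux p (grad h e) * grad (indicator {x}) e)) \<partial>count_space edges)"
    unfolding pairing_def grad[of _] by (simp add: sum_distrib_left mult_ac)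
  also have "\<dots> = (\<Sum>x\<in>S. g x * pairing h (indicator {x}))"
    unfolding pairing_def
    by (subst Bochner_Integration.integral_sum) (auto intro!: integrable_mult_right integrable_pairing h dir)
  also have "\<dots> = 0"
    using h(2) by (simp add: pairing_indicator p_harmonic_def)
  finally show ?thesis .
qed

section \<open>The closure of the finitely supported functions\<close>

lemma D_norm_lt_iff:
  assumes "dirichlet f" "\<epsilon> > 0"
  shows "D_norm E p o' f < \<epsilon> \<longleftrightarrow> energy f + \<bar>f o'\<bar> powr p < \<epsilon> powr p"
proof -
  define s where "s = energy f + \<bar>f o'\<bar> powr p"
  have s: "s \<ge> 0" by (simp add: s_def energy_nonneg)
  have "D_norm E p o' f = s powr (1 / p)"
    by (simp add: D_norm_def s_def p_energy_eq_energy[OF assms(1)] energy_nonneg)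
  moreover have "s powr (1 / p) < \<epsilon> \<longleftrightarrow> (s powr (1 / p)) powr p < \<epsilon> powr p"
    using assms p_gt_1 powr_less_mono2[of p "s powr (1 / p)" \<epsilon>] powr_mono2[of p \<epsilon> "s powr (1 / p)"]
    by (auto simp del: powr_powr simp: not_less[symmetric])
  moreover have "(s powr (1 / p)) powr p = s" using p_gt_1 s by (simp add: powr_powr)
  ultimately show ?thesis by (simp add: s_def)
qed

lemma D_closure_fsI:
  assumes f: "dirichlet f" and g: "\<And>n. g n \<in> finitely_supported"
    and lim: "(\<lambda>n. energy (\<lambda>x. f x - g n x)) \<longlonglongrightarrow> 0" and o: "(\<lambda>n. g n o') \<longlonglongrightarrow> f o'"
  shows "f \<in> D_closure_fs E p o'"
proof -
  have "\<exists>g\<in>finitely_supported. D_norm E p o' (\<lambda>x. f x - g x) < \<epsilon>" if "\<epsilon> > 0" for \<epsilon>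
  proof -
    have "(\<lambda>n. \<bar>f o' - g n o'\<bar> powr p) \<longlonglongrightarrow> \<bar>f o' - f o'\<bar> powr p"
      using p_gt_1 by (intro tendsto_powr' tendsto_intros o) auto
    then have "(\<lambda>n. energy (\<lambda>x. f x - g n x) + \<bar>f o' - g n o'\<bar> powr p) \<longlonglongrightarrow> 0 + 0"
      by (intro tendsto_add lim) simp
    moreover have "0 + 0 < \<epsilon> powr p" using that by simp
    ultimately have "\<forall>\<^sub>F n in sequentially. energy (\<lambda>x. f x - g n x) + \<bar>f o' - g n o'\<bar> powr p < \<epsilon> powr p"
      by (rule order_tendstoD)
    then obtain n where "energy (\<lambda>x. f x - g n x) + \<bar>f o' - g n o'\<bar> powr p < \<epsilon> powr p"
      by (auto simp: eventually_sequentially)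
    then have "D_norm E p o' (\<lambda>x. f x - g n x) < \<epsilon>"
      using that D_norm_lt_iff[OF dirichlet_diff(1)[OF f finitely_supported_dirichlet[OF g]]] by simp
    then show ?thesis using g by blast
  qed
  then show ?thesis using f by (simp add: D_closure_fs_def D_space_iff_dirichlet)
qed

lemma D_closure_fsE:
  assumes "f \<in> D_closure_fs E p o'"
  obtains g where "dirichlet f" "\<And>n::nat. g n \<in> finitely_supported"
    and "(\<lambda>n. energy (\<lambda>x. f x - g n x)) \<longlonglongrightarrow> 0" and "\<And>x. (\<lambda>n. g n x) \<longlonglongrightarrow> f x"
proof -
  have f: "dirichlet f" using assms by (simp add: D_closure_fs_def D_space_iff_dirichlet)
  have "\<exists>g\<in>finitely_supported. D_norm E p o' (\<lambda>x. f x - g x) < inverse (real (Suc n)) powr (1 / p)" for n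
    using assms by (simp add: D_closure_fs_def)
  then obtain g where g: "\<And>n. g n \<in> finitely_supported"
    and g_lt: "\<And>n. D_norm E p o' (\<lambda>x. f x - g n x) < inverse (real (Suc n)) powr (1 / p)"
    by metis
  have D: "dirichlet (\<lambda>x. f x - g n x)" for n
    by (rule dirichlet_diff(1)[OF f finitely_supported_dirichlet[OF g]])
  have lt: "energy (\<lambda>x. f x - g n x) + \<bar>f o' - g n o'\<bar> powr p < inverse (real (Suc n))" for n
    using g_lt[of n] D_norm_lt_iff[OF D, of "inverse (real (Suc n)) powr (1 / p)" n] p_gt_1
    by (simp add: powr_powr)
  have lim: "(\<lambda>n. energy (\<lambda>x. f x - g n x)) \<longlonglongrightarrow> 0"
  proof (rule Lim_null_comparison[OF always_eventually[OF allI] LIMSEQ_inverse_real_of_nat])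
    show "norm (energy (\<lambda>x. f x - g n x)) \<le> inverse (real (Suc n))" for n
      using lt[of n] powr_ge_zero[of "\<bar>f o' - g n o'\<bar>" p] energy_nonneg[of "\<lambda>x. f x - g n x"]
      unfolding real_norm_def by linarith
  qed
  have "(\<lambda>n. \<bar>f o' - g n o'\<bar> powr p) \<longlonglongrightarrow> 0"
  proof (rule Lim_null_comparison[OF always_eventually[OF allI] LIMSEQ_inverse_real_of_nat])
    show "norm (\<bar>f o' - g n o'\<bar> powr p) \<le> inverse (real (Suc n))" for n
      using lt[of n] powr_ge_zero[of "\<bar>f o' - g n o'\<bar>" p] energy_nonneg[of "\<lambda>x. f x - g n x"]
      unfolding real_norm_def by linarith
  qed
  then have "(\<lambda>n. (\<bar>f o' - g n o'\<bar> powr p) powr (1 / p)) \<longlonglongrightarrow> 0 powr (1 / p)"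
    using p_gt_1 by (intro tendsto_powr') auto
  then have "(\<lambda>n. \<bar>f o' - g n o'\<bar>) \<longlonglongrightarrow> 0" using p_gt_1 by (simp add: powr_powr)
  then have "(\<lambda>n. f o' - g n o') \<longlonglongrightarrow> 0" by (rule tendsto_rabs_zero_cancel)
  then have "(\<lambda>n. f x - g n x) \<longlonglongrightarrow> 0" for x
    by (rule tendsto_of_energy_tendsto[where w = "\<lambda>n x. f x - g n x", OF D lim])
  then have "(\<lambda>n. f x - (f x - g n x)) \<longlonglongrightarrow> f x - 0" for x
    by (intro tendsto_diff tendsto_const)
  then have "(\<lambda>n. g n x) \<longlonglongrightarrow> f x" for x by simp
  then show thesis by (rule that[OF f g lim])
qed

text \<open>
  The pairing with a harmonic \<open>h\<close> is continuous in the energy, by Young's inequality with a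
  parameter, so it vanishes on limits of finitely supported functions as well.
\<close>
lemma pairing_D_closure:
  assumes h: "dirichlet h" "p_harmonic E p h" and f: "f \<in> D_closure_fs E p o'"
  shows "pairing h f = 0"
proof -
  obtain g where f': "dirichlet f" and g: "\<And>n::nat. g n \<in> finitely_supported"
    and lim: "(\<lambda>n. energy (\<lambda>x. f x - g n x)) \<longlonglongrightarrow> 0"
    using D_closure_fsE[OF f] by metis
  have D: "dirichlet (\<lambda>x. f x - g n x)" for n
    by (rule dirichlet_diff(1)[OF f' finitely_supported_dirichlet[OF g]])
  have eq: "pairing h f = pairing h (\<lambda>x. f x - g n x)" for n
  proof -
    have "pairing h (\<lambda>x. g n x + (f x - g n x)) = pairing h (g n) + pairing h (\<lambda>x. f x - g n x)"
      by (rule pairing_add[OF h(1) finitely_supported_dirichlet[OF g] D])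
    then show ?thesis using pairing_finitely_supported[OF h g] by simp
  qed
  have le: "\<bar>pairing h f\<bar> \<le> \<eta> * energy h" if "\<eta> > 0" for \<eta>
  proof (rule LIMSEQ_le_const)
    have "(\<lambda>n. \<eta> * energy h + \<eta> powr (1 - p) * energy (\<lambda>x. f x - g n x))
        \<longlonglongrightarrow> \<eta> * energy h + \<eta> powr (1 - p) * 0"
      by (intro tendsto_intros lim)
    then show "(\<lambda>n. \<eta> * energy h + \<eta> powr (1 - p) * energy (\<lambda>x. f x - g n x)) \<longlonglongrightarrow> \<eta> * energy h"
      by simp
    show "\<exists>N. \<forall>n\<ge>N. \<bar>pairing h f\<bar> \<le> \<eta> * energy h + \<eta> powr (1 - p) * energy (\<lambda>x. f x - g n x)"
      using abs_pairing_le[OF h(1) D that] eq by metis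
  qed
  have "((\<lambda>\<eta>. \<eta> * energy h) \<longlongrightarrow> 0 * energy h) (at_right 0)"
    by (intro tendsto_intros)
  then have "\<bar>pairing h f\<bar> \<le> 0 * energy h"
  proof (rule tendsto_lowerbound)
    show "\<forall>\<^sub>F \<eta> in at_right 0. \<bar>pairing h f\<bar> \<le> \<eta> * energy h"
      using le by (auto simp: eventually_at_filter)
  qed simp
  then show ?thesis by simp
qed


text \<open>
  Uniform convexity at work. Choose \<open>w n\<close> in \<open>C n\<close> with almost minimal energy. The minimal energies
  of the decreasing sets \<open>C n\<close> increase to a finite limit. For \<open>i, j \<ge> N\<close> the midpoint of \<open>w i\<close> and
  \<open>w j\<close> lies in \<open>C N\<close>, so its energy is not much smaller than that of \<open>w i\<close> and \<open>w j\<close>, and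
  uniform convexity makes the energy of \<open>w i - w j\<close> small. With a constant sequence \<open>C\<close> this gives
  convergent minimizing sequences, with tails of a pointwise convergent sequence it plays the
  role of Mazur's lemma.
\<close>
lemma energy_cauchy_selection:
  assumes anti: "\<And>m n. m \<le> n \<Longrightarrow> C n \<subseteq> C m"
    and dir: "\<And>n u. u \<in> C n \<Longrightarrow> dirichlet u"
    and mid: "\<And>n u v. u \<in> C n \<Longrightarrow> v \<in> C n \<Longrightarrow> (\<lambda>x. (u x + v x) / 2) \<in> C n"
    and bound: "\<And>n. \<exists>u\<in>C n. energy u \<le> K"
  obtains w where "\<And>n::nat. w n \<in> C n"
    and "\<And>n u. u \<in> C n \<Longrightarrow> energy (w n) \<le> energy u + inverse (real (Suc n))"
    and "\<And>\<epsilon>. \<epsilon> > 0 \<Longrightarrow> \<exists>N. \<forall>i\<ge>N. \<forall>j\<ge>N. energy (\<lambda>x. w i x - w j x) < \<epsilon>"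
proof -
  define m where "m n = Inf (energy ` C n)" for n
  have bdd: "bdd_below (energy ` C n)" for n
    by (rule bdd_belowI[of _ 0]) (auto simp: energy_nonneg)
  have ne: "C n \<noteq> {}" for n using bound by blast
  have m_le: "m n \<le> energy u" if "u \<in> C n" for n u
    unfolding m_def using that by (intro cInf_lower bdd) auto
  have m_le_K: "m n \<le> K" for n
    using bound[of n] m_le by force
  have m_nonneg: "m n \<ge> 0" for n
    unfolding m_def using ne by (intro cInf_greatest) (auto simp: energy_nonneg)
  have inc: "incseq m"
    unfolding m_def using ne bdd by (intro incseq_def[THEN iffD2] allI impI cInf_superset_mono image_mono anti) auto
  obtain L where L: "m \<longlonglongrightarrow> L" "\<And>n. m n \<le> L"
    using incseq_convergent[OF inc, of K] m_le_K by blast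
  have "\<exists>u\<in>C n. energy u < m n + inverse (real (Suc n))" for n
    using cInf_lessD[of "energy ` C n" "m n + inverse (real (Suc n))"] ne[of n]
    by (auto simp: m_def)
  then obtain w where w: "\<And>n. w n \<in> C n" and w_lt: "\<And>n. energy (w n) < m n + inverse (real (Suc n))"
    by metis
  have cauchy: "\<exists>N. \<forall>i\<ge>N. \<forall>j\<ge>N. energy (\<lambda>x. w i x - w j x) < \<epsilon>" if "\<epsilon> > 0" for \<epsilon>
  proof -
    define \<eta> where "\<eta> = \<epsilon> / (4 * (K + 1))"
    have "K \<ge> 0" using m_nonneg[of 0] m_le_K[of 0] by linarith
    then have "K + 1 \<noteq> 0" "K + 1 > 0" by auto
    then have \<eta>: "\<eta> > 0" "\<eta> * (2 * (K + 1)) = \<epsilon> / 2"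
      using that by (simp_all add: \<eta>_def del: distrib_left_numeral)
    obtain B where B: "B > 0"
      "\<And>a b. \<bar>a - b\<bar> powr p \<le> \<eta> * (\<bar>a\<bar> powr p + \<bar>b\<bar> powr p)
            + B * ((\<bar>a\<bar> powr p + \<bar>b\<bar> powr p) / 2 - \<bar>(a + b) / 2\<bar> powr p)"
      using abs_powr_uniformly_convex[OF p_gt_1 \<eta>(1)] by blast
    \<comment> \<open>the pointwise inequality, summed over all edges\<close>
    have energy_le: "energy (\<lambda>x. u x - v x) \<le> \<eta> * (energy u + energy v)
        + B * ((energy u + energy v) / 2 - energy (\<lambda>x. (u x + v x) / 2))"
      if "dirichlet u" "dirichlet v" for u v
    proof -
      let ?h = "\<lambda>e. \<eta> * (\<bar>grad u e\<bar> powr p + \<bar>grad v e\<bar> powr p)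
        + B * ((\<bar>grad u e\<bar> powr p + \<bar>grad v e\<bar> powr p) / 2 - \<bar>grad (\<lambda>x. (u x + v x) / 2) e\<bar> powr p)"
      have le: "\<bar>grad (\<lambda>x. u x - v x) e\<bar> powr p \<le> ?h e" for e
      proof -
        have "grad (\<lambda>x. u x - v x) e = grad u e - grad v e"
          "grad (\<lambda>x. (u x + v x) / 2) e = (grad u e + grad v e) / 2"
          by (simp_all add: grad_def field_simps)
        then show ?thesis using B(2)[of "grad u e" "grad v e"] by (simp only:)
      qed
      note ints = that[unfolded dirichlet_def] dirichlet_midpoint[OF that, unfolded dirichlet_def]
      have "energy (\<lambda>x. u x - v x) \<le> (\<integral>e. ?h e \<partial>count_space edges)"
        by (rule dirichlet_bound(2)[OF _ le]) (use ints in auto)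
      also have "\<dots> = \<eta> * (energy u + energy v)
          + B * ((energy u + energy v) / 2 - energy (\<lambda>x. (u x + v x) / 2))"
        using ints by (simp add: energy_def)
      finally show ?thesis .
    qed
    \<comment> \<open>\<open>\<delta>\<close> is the admissible gap in the midpoint inequality for the energy\<close>
    define \<delta> where "\<delta> = \<epsilon> / (2 * B)"
    have \<delta>: "\<delta> > 0" "B * \<delta> = \<epsilon> / 2" using that B(1) by (simp_all add: \<delta>_def)
    have "(\<lambda>n. m n - inverse (real (Suc n))) \<longlonglongrightarrow> L - 0"
      by (intro tendsto_diff L LIMSEQ_inverse_real_of_nat)
    moreover have "L - \<delta> < L - 0" using \<delta> by simp
    ultimately have "\<forall>\<^sub>F n in sequentially. L - \<delta> < m n - inverse (real (Suc n))"
      by (rule order_tendstoD)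
    then obtain N where N: "L - \<delta> < m N - inverse (real (Suc N))"
      by (auto simp: eventually_sequentially)
    have "energy (\<lambda>x. w i x - w j x) < \<epsilon>" if "i \<ge> N" "j \<ge> N" for i j
    proof -
      have upper: "energy (w k) < L + inverse (real (Suc N))" "energy (w k) < K + 1" if "k \<ge> N" for k
      proof -
        have "inverse (real (Suc k)) \<le> inverse (real (Suc N))" "inverse (real (Suc k)) \<le> 1"
          using that by (auto simp: field_simps)
        then show "energy (w k) < L + inverse (real (Suc N))" "energy (w k) < K + 1"
          using w_lt[of k] L(2)[of k] m_le_K[of k] by linarith+
      qed
      have inN: "w i \<in> C N" "w j \<in> C N" using w anti that by blast+
      have mid_ge: "m N \<le> energy (\<lambda>x. (w i x + w j x) / 2)"
        by (intro m_le mid inN)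
      have gap: "(energy (w i) + energy (w j)) / 2 - energy (\<lambda>x. (w i x + w j x) / 2) < \<delta>"
      proof -
        have "energy (w i) + energy (w j) < (\<delta> + m N) * 2"
          using upper(1)[OF that(1)] upper(1)[OF that(2)] N by argo
        then have "(energy (w i) + energy (w j)) / 2 < \<delta> + m N" by simp
        with mid_ge show ?thesis by linarith
      qed
      have "energy (\<lambda>x. w i x - w j x) \<le> \<eta> * (energy (w i) + energy (w j))
          + B * ((energy (w i) + energy (w j)) / 2 - energy (\<lambda>x. (w i x + w j x) / 2))"
        by (intro energy_le dir[OF inN(1)] dir[OF inN(2)])
      also have "\<dots> < \<eta> * (2 * (K + 1)) + B * \<delta>"
        using upper(2)[OF that(1)] upper(2)[OF that(2)] \<eta>(1) B(1) gap
        by (intro add_le_less_mono mult_left_mono mult_strict_left_mono) auto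
      finally show ?thesis using \<eta> \<delta> by simp
    qed
    then show ?thesis by blast
  qed
  show thesis
  proof (rule that[OF w _ cauchy])
    show "energy (w n) \<le> energy u + inverse (real (Suc n))" if "u \<in> C n" for n u
      using w_lt[of n] m_le[OF that] by linarith
  qed
qed

text \<open>
  Fatou's lemma applied to \<open>w i - w j\<close> as \<open>j\<close> tends to infinity.
\<close>
lemma energy_cauchy_limit:
  assumes dir: "\<And>n. dirichlet (w n)"
    and cauchy: "\<And>\<epsilon>. \<epsilon> > 0 \<Longrightarrow> \<exists>N. \<forall>i\<ge>N. \<forall>j\<ge>N. energy (\<lambda>x. w i x - w j x) < \<epsilon>"
    and lim: "\<And>x. (\<lambda>n. w n x) \<longlonglongrightarrow> v x"
  shows "dirichlet v" and "(\<lambda>n. energy (\<lambda>x. w n x - v x)) \<longlonglongrightarrow> 0"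
proof -
  have D: "dirichlet (\<lambda>x. w i x - w j x)" for i j
    by (intro dirichlet_diff dir)
  have pt: "(\<lambda>j. w i x - w j x) \<longlonglongrightarrow> w i x - v x" for i x
    by (intro tendsto_intros lim)
  have ev: "\<exists>N. \<forall>i\<ge>N. dirichlet (\<lambda>x. w i x - v x) \<and> energy (\<lambda>x. w i x - v x) \<le> \<epsilon>" if "\<epsilon> > 0" for \<epsilon>
  proof -
    from cauchy[OF that]
    obtain N where N: "\<And>i j. i \<ge> N \<Longrightarrow> j \<ge> N \<Longrightarrow> energy (\<lambda>x. w i x - w j x) < \<epsilon>"
      by blast
    have "\<forall>\<^sub>F j in sequentially. energy (\<lambda>x. w i x - w j x) \<le> \<epsilon>" if "i \<ge> N" for i
      using N[OF that] by (auto simp: eventually_sequentially intro: less_imp_le)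
    then have "dirichlet (\<lambda>x. w i x - v x) \<and> energy (\<lambda>x. w i x - v x) \<le> \<epsilon>" if "i \<ge> N" for i
      using dirichlet_Fatou[where w = "\<lambda>j x. w i x - w j x" and v = "\<lambda>x. w i x - v x" and K = \<epsilon>, OF D pt] that
      by blast
    then show ?thesis by blast
  qed
  obtain N where "dirichlet (\<lambda>x. w N x - v x)" using ev[of 1] by auto
  from dirichlet_diff(1)[OF dir[of N] this] show "dirichlet v" by simp
  show "(\<lambda>n. energy (\<lambda>x. w n x - v x)) \<longlonglongrightarrow> 0"
  proof (rule LIMSEQ_I)
    fix r :: real assume "r > 0"
    then obtain N where N: "\<forall>i\<ge>N. energy (\<lambda>x. w i x - v x) \<le> r / 2" using ev[of "r / 2"] by auto
    have "norm (energy (\<lambda>x. w n x - v x) - 0) < r" if "n \<ge> N" for n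
    proof -
      have "energy (\<lambda>x. w n x - v x) \<le> r / 2" using N that by blast
      then show ?thesis using \<open>r > 0\<close> energy_nonneg[of "\<lambda>x. w n x - v x"] by simp
    qed
    then show "\<exists>no. \<forall>n\<ge>no. norm (energy (\<lambda>x. w n x - v x) - 0) < r" by blast
  qed
qed

lemma energy_cauchy_pointwise:
  assumes dir: "\<And>n. dirichlet (w n)"
    and cauchy: "\<And>\<epsilon>. \<epsilon> > 0 \<Longrightarrow> \<exists>N. \<forall>i\<ge>N. \<forall>j\<ge>N. energy (\<lambda>x. w i x - w j x) < \<epsilon>"
    and a: "convergent (\<lambda>n. w n a)"
  shows "convergent (\<lambda>n. w n x)"
proof -
  have edge: "convergent (\<lambda>n. w n z - w n y)" if "E y z" for y z
  proof (rule Cauchy_convergent, rule CauchyI)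
    fix r :: real assume "r > 0"
    then obtain N where N: "\<And>i j. i \<ge> N \<Longrightarrow> j \<ge> N \<Longrightarrow> energy (\<lambda>x. w i x - w j x) < r powr p"
      using cauchy[of "r powr p"] by auto
    have "norm ((w i z - w i y) - (w j z - w j y)) < r" if "i \<ge> N" "j \<ge> N" for i j
    proof (rule ccontr)
      assume "\<not> ?thesis"
      then have "r powr p \<le> \<bar>(w i z - w j z) - (w i y - w j y)\<bar> powr p"
        using \<open>r > 0\<close> p_gt_1 by (intro powr_mono2) (auto simp: algebra_simps)
      also have "\<dots> \<le> energy (\<lambda>x. w i x - w j x)"
        by (intro grad_powr_le_energy dirichlet_diff dir \<open>E y z\<close>)
      also have "\<dots> < r powr p" by (rule N[OF that])
      finally show False by simp
    qed
    then show "\<exists>M. \<forall>m\<ge>M. \<forall>n\<ge>M. norm ((w m z - w m y) - (w n z - w n y)) < r" by blast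
  qed
  have "E\<^sup>*\<^sup>* a x" using connected_E by (simp add: connected_graph_def)
  then show ?thesis
  proof induction
    case (step y z)
    from convergent_add[OF step.IH edge[OF step.hyps(2)]] show ?case by simp
  qed (rule a)
qed

lemma D_closure_fs_weakE:
  assumes "f \<in> D_closure_fs E p o'"
  obtains g K where "\<And>n::nat. g n \<in> finitely_supported" "\<And>n. energy (g n) \<le> K"
    and "\<And>x. (\<lambda>n. g n x) \<longlonglongrightarrow> f x"
proof -
  obtain g where f: "dirichlet f" and g: "\<And>n::nat. g n \<in> finitely_supported"
    and lim: "(\<lambda>n. energy (\<lambda>x. f x - g n x)) \<longlonglongrightarrow> 0" and pt: "\<And>x. (\<lambda>n. g n x) \<longlonglongrightarrow> f x"
    using D_closure_fsE[OF assms] by metis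
  have "Bseq (\<lambda>n. energy (\<lambda>x. f x - g n x))"
    by (rule convergent_imp_Bseq[OF convergentI[OF lim]])
  then obtain K where K: "\<And>n. \<bar>energy (\<lambda>x. f x - g n x)\<bar> \<le> K"
    by (auto simp: Bseq_def)
  have "energy (g n) \<le> 2 powr p * (energy f + K)" for n
  proof -
    have D: "dirichlet (\<lambda>x. f x - g n x)"
      by (rule dirichlet_diff(1)[OF f finitely_supported_dirichlet[OF g]])
    have "energy (g n) \<le> 2 powr p * (energy f + energy (\<lambda>x. f x - g n x))"
      using dirichlet_diff(2)[OF f D] by simp
    also have "\<dots> \<le> 2 powr p * (energy f + K)"
      using K[of n] by (intro mult_left_mono add_mono) auto
    finally show ?thesis .
  qed
  then show thesis using that g pt by blast
qed

text \<open>
  The analogue of the fact that a convex set is weakly closed if it is norm closed. It is what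
  makes the closure easy to handle, since
  truncating or multiplying the approximants preserves pointwise convergence and bounded energy,
  whereas energy convergence would have to be checked anew.

  The sets \<open>C n\<close> consist of differences \<open>u = g - f\<close> with finitely supported \<open>g\<close> that are dominated at
  each vertex by every bound for the tail from \<open>n\<close> on of the given sequence. They are
  midpoint convex and decreasing, and an energy Cauchy sequence selected from them tends to
  zero pointwise, hence in energy.
\<close>
lemma D_closure_fs_weakI:
  assumes g: "\<And>n::nat. g n \<in> finitely_supported" and K: "\<And>n. energy (g n) \<le> K"
    and pt: "\<And>x. (\<lambda>n. g n x) \<longlonglongrightarrow> f x"
  shows "f \<in> D_closure_fs E p o'"
proof -
  note Dg = finitely_supported_dirichlet[OF g]
  have f: "dirichlet f" "energy f \<le> K"
    using dirichlet_Fatou[OF Dg pt, of K] K by auto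
  define C where "C n = {u. (\<lambda>x. u x + f x) \<in> finitely_supported \<and>
      (\<forall>x e. (\<forall>k\<ge>n. \<bar>g k x - f x\<bar> \<le> e) \<longrightarrow> \<bar>u x\<bar> \<le> e)}" for n
  have dirC: "dirichlet u" if "u \<in> C n" for n u
  proof -
    have "dirichlet (\<lambda>x. u x + f x)"
      using that by (intro finitely_supported_dirichlet) (simp add: C_def)
    from dirichlet_diff(1)[OF this f(1)] show ?thesis by simp
  qed
  obtain w where w: "\<And>n. w n \<in> C n"
    and cauchy: "\<And>\<epsilon>. \<epsilon> > 0 \<Longrightarrow> \<exists>N. \<forall>i\<ge>N. \<forall>j\<ge>N. energy (\<lambda>x. w i x - w j x) < \<epsilon>"
  proof (rule energy_cauchy_selection[of C "2 powr p * (K + K)"])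
    show "C n \<subseteq> C m" if "m \<le> n" for m n
    proof
      fix u assume u: "u \<in> C n"
      have "\<bar>u x\<bar> \<le> e" if "\<forall>k\<ge>m. \<bar>g k x - f x\<bar> \<le> e" for x e
        using u that \<open>m \<le> n\<close> by (auto simp: C_def)
      then show "u \<in> C m" using u by (simp add: C_def)
    qed
    show "(\<lambda>x. (u x + v x) / 2) \<in> C n" if "u \<in> C n" "v \<in> C n" for n u v
    proof -
      have "{x. (u x + v x) / 2 + f x \<noteq> 0} \<subseteq> {x. u x + f x \<noteq> 0} \<union> {x. v x + f x \<noteq> 0}"
        by (auto simp: field_simps)
      then have "(\<lambda>x. (u x + v x) / 2 + f x) \<in> finitely_supported"
        using that by (auto simp: C_def finitely_supported_def intro: finite_subset)
      moreover have "\<bar>(u x + v x) / 2\<bar> \<le> e" if "\<forall>k\<ge>n. \<bar>g k x - f x\<bar> \<le> e" for x e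
      proof -
        have "\<bar>u x\<bar> \<le> e" "\<bar>v x\<bar> \<le> e"
          using \<open>u \<in> C n\<close> \<open>v \<in> C n\<close> that unfolding C_def by blast+
        then show ?thesis by (auto simp: abs_le_iff)
      qed
      ultimately show ?thesis by (simp add: C_def)
    qed
    show "\<exists>u\<in>C n. energy u \<le> 2 powr p * (K + K)" for n
    proof
      show "(\<lambda>x. g n x - f x) \<in> C n" using g by (simp add: C_def)
      have "energy (\<lambda>x. g n x - f x) \<le> 2 powr p * (energy (g n) + energy f)"
        by (rule dirichlet_diff(2)[OF Dg f(1)])
      also have "\<dots> \<le> 2 powr p * (K + K)"
        by (intro mult_left_mono add_mono K f) auto
      finally show "energy (\<lambda>x. g n x - f x) \<le> 2 powr p * (K + K)" .
    qed
  qed (use dirC in auto)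
  have w0: "(\<lambda>n. w n x) \<longlonglongrightarrow> 0" for x
  proof (rule LIMSEQ_I)
    fix r :: real assume "r > 0"
    then obtain N where N: "\<And>k. k \<ge> N \<Longrightarrow> \<bar>g k x - f x\<bar> < r / 2"
      using LIMSEQ_D[OF pt[of x], of "r / 2"] by auto
    have "norm (w n x - 0) < r" if "n \<ge> N" for n
    proof -
      have "\<forall>k\<ge>n. \<bar>g k x - f x\<bar> \<le> r / 2" using N that by (auto intro: less_imp_le)
      then have "\<bar>w n x\<bar> \<le> r / 2" using w[of n] unfolding C_def by blast
      then show ?thesis using \<open>r > 0\<close> by simp
    qed
    then show "\<exists>no. \<forall>n\<ge>no. norm (w n x - 0) < r" by blast
  qed
  have lim: "(\<lambda>n. energy (\<lambda>x. w n x - 0)) \<longlonglongrightarrow> 0"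
    by (rule energy_cauchy_limit(2)[OF dirC[OF w] cauchy w0])
  show ?thesis
  proof (rule D_closure_fsI[OF f(1)])
    show "(\<lambda>x. w n x + f x) \<in> finitely_supported" for n using w[of n] by (simp add: C_def)
    have "energy (\<lambda>x. f x - (w n x + f x)) = energy (\<lambda>x. w n x - 0)" for n
      using energy_diff_commute[of "w n" "\<lambda>x. 0"] by simp
    then show "(\<lambda>n. energy (\<lambda>x. f x - (w n x + f x))) \<longlonglongrightarrow> 0" using lim by simp
    show "(\<lambda>n. w n o' + f o') \<longlonglongrightarrow> f o'"
      using tendsto_add[OF w0[of o'] tendsto_const[of "f o'"]] by simp
  qed
qed

lemma dirichlet_mult:
  assumes f: "dirichlet f" and g: "dirichlet g"
    and A: "\<And>x. \<bar>f x\<bar> \<le> A" and B: "\<And>x. \<bar>g x\<bar> \<le> B"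
  shows "dirichlet (\<lambda>x. f x * g x)"
    and "energy (\<lambda>x. f x * g x) \<le> 2 powr p * (A powr p * energy g + B powr p * energy f)"
proof -
  let ?h = "\<lambda>e. 2 powr p * (A powr p * \<bar>grad g e\<bar> powr p + B powr p * \<bar>grad f e\<bar> powr p)"
  have int: "integrable (count_space edges) ?h"
    using f g by (auto simp: dirichlet_def)
  have le: "\<bar>grad (\<lambda>x. f x * g x) e\<bar> powr p \<le> ?h e" for e
  proof -
    have "grad (\<lambda>x. f x * g x) e = f (snd e) * grad g e + g (fst e) * grad f e"
      by (simp add: grad_def algebra_simps)
    then have "\<bar>grad (\<lambda>x. f x * g x) e\<bar> powr p
        \<le> 2 powr p * (\<bar>f (snd e) * grad g e\<bar> powr p + \<bar>g (fst e) * grad f e\<bar> powr p)"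
      by (simp only: abs_add_powr_le[OF p_gt_1])
    also have "\<dots> = 2 powr p * (\<bar>f (snd e)\<bar> powr p * \<bar>grad g e\<bar> powr p + \<bar>g (fst e)\<bar> powr p * \<bar>grad f e\<bar> powr p)"
      by (simp add: abs_mult powr_mult)
    also have "\<dots> \<le> ?h e"
      using A B p_gt_1 by (intro mult_left_mono add_mono mult_right_mono powr_mono2) auto
    finally show ?thesis .
  qed
  show "dirichlet (\<lambda>x. f x * g x)" by (rule dirichlet_bound(1)[OF int le])
  show "energy (\<lambda>x. f x * g x) \<le> 2 powr p * (A powr p * energy g + B powr p * energy f)"
    using dirichlet_bound(2)[OF int le] f g by (simp add: energy_def dirichlet_def)
qed

section \<open>The ideal of bounded functions in the closure\<close>

abbreviation BD :: "('v \<Rightarrow> real) set" where "BD \<equiv> BD_space E p"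
abbreviation BD\<^sub>0 :: "('v \<Rightarrow> real) set" where "BD\<^sub>0 \<equiv> BD_closure_fs E p o'"

lemma BD_iff: "f \<in> BD \<longleftrightarrow> dirichlet f \<and> (\<exists>M. \<forall>x. \<bar>f x\<bar> \<le> M)"
  by (simp add: BD_space_def D_space_iff_dirichlet bounded_functions_def bounded_iff)

lemma BD\<^sub>0_iff: "f \<in> BD\<^sub>0 \<longleftrightarrow> f \<in> D_closure_fs E p o' \<and> (\<exists>M. \<forall>x. \<bar>f x\<bar> \<le> M)"
  by (simp add: BD_closure_fs_def bounded_functions_def bounded_iff)

lemma BD\<^sub>0_subset_BD: "f \<in> BD\<^sub>0 \<Longrightarrow> f \<in> BD"
  by (auto simp: BD\<^sub>0_iff BD_iff D_closure_fs_def D_space_iff_dirichlet)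

lemma BD_const: "(\<lambda>x. c) \<in> BD"
  by (auto simp: BD_iff dirichlet_const)

lemma BD_add:
  assumes "f \<in> BD" "g \<in> BD"
  shows "(\<lambda>x. f x + g x) \<in> BD"
proof -
  obtain A B where "\<And>x. \<bar>f x\<bar> \<le> A" "\<And>x. \<bar>g x\<bar> \<le> B" using assms by (auto simp: BD_iff)
  then have "\<bar>f x + g x\<bar> \<le> A + B" for x by (meson abs_triangle_ineq add_mono order_trans)
  then show ?thesis using assms by (auto simp: BD_iff intro: dirichlet_add)
qed

lemma BD_mult:
  assumes "f \<in> BD" "g \<in> BD"
  shows "(\<lambda>x. f x * g x) \<in> BD"
proof -
  obtain A B where AB: "\<And>x. \<bar>f x\<bar> \<le> A" "\<And>x. \<bar>g x\<bar> \<le> B" using assms by (auto simp: BD_iff)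
  have "\<bar>f x * g x\<bar> \<le> A * B" for x
    unfolding abs_mult using AB by (intro mult_mono) (auto intro: order_trans[OF abs_ge_zero])
  then show ?thesis using assms dirichlet_mult(1)[OF _ _ AB] by (auto simp: BD_iff)
qed

lemma BD_contraction:
  assumes "f \<in> BD" "\<And>a b. \<bar>\<phi> a - \<phi> b\<bar> \<le> \<bar>a - b\<bar>"
  shows "(\<lambda>x. \<phi> (f x)) \<in> BD"
proof -
  obtain M where M: "\<And>x. \<bar>f x\<bar> \<le> M" using assms by (auto simp: BD_iff)
  have "\<bar>\<phi> (f x)\<bar> \<le> \<bar>\<phi> 0\<bar> + M" for x using assms(2)[of "f x" 0] M[of x] by linarith
  then show ?thesis using assms by (auto simp: BD_iff intro: dirichlet_contraction(1))
qed

lemma finitely_supported_BD\<^sub>0: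
  assumes "g \<in> finitely_supported"
  shows "g \<in> BD\<^sub>0"
proof -
  have "g \<in> D_closure_fs E p o'"
    by (rule D_closure_fs_weakI[of "\<lambda>n. g" "energy g"]) (use assms in auto)
  moreover have "finite (range g)"
  proof (rule finite_subset)
    show "range g \<subseteq> insert 0 (g ` {x. g x \<noteq> 0})" by auto
  qed (use assms in \<open>simp add: finitely_supported_def\<close>)
  then have "bounded (range g)" by (rule finite_imp_bounded)
  ultimately show ?thesis by (simp add: BD_closure_fs_def bounded_functions_def)
qed

lemma BD\<^sub>0_approximation:
  assumes "f \<in> BD\<^sub>0"
  obtains a K where "\<And>n::nat. a n \<in> finitely_supported" "\<And>n. energy (a n) \<le> K"
    and "\<And>x. (\<lambda>n. a n x) \<longlonglongrightarrow> f x"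
proof -
  have "f \<in> D_closure_fs E p o'" using assms by (simp add: BD\<^sub>0_iff)
  then show thesis by (rule D_closure_fs_weakE) (rule that)
qed

lemma BD\<^sub>0_add:
  assumes "f \<in> BD\<^sub>0" "g \<in> BD\<^sub>0"
  shows "(\<lambda>x. f x + g x) \<in> BD\<^sub>0"
proof -
  obtain a K where a: "\<And>n::nat. a n \<in> finitely_supported" "\<And>n. energy (a n) \<le> K" "\<And>x. (\<lambda>n. a n x) \<longlonglongrightarrow> f x"
    by (rule BD\<^sub>0_approximation[OF assms(1)]) (rule that)
  obtain b L where b: "\<And>n::nat. b n \<in> finitely_supported" "\<And>n. energy (b n) \<le> L" "\<And>x. (\<lambda>n. b n x) \<longlonglongrightarrow> g x"
    by (rule BD\<^sub>0_approximation[OF assms(2)]) (rule that)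
  have "(\<lambda>x. f x + g x) \<in> D_closure_fs E p o'"
  proof (rule D_closure_fs_weakI)
    show "(\<lambda>x. a n x + b n x) \<in> finitely_supported" for n
    proof -
      have "{x. a n x + b n x \<noteq> 0} \<subseteq> {x. a n x \<noteq> 0} \<union> {x. b n x \<noteq> 0}" by auto
      then show ?thesis using a(1)[of n] b(1)[of n]
        by (auto simp: finitely_supported_def intro: finite_subset)
    qed
    show "energy (\<lambda>x. a n x + b n x) \<le> 2 powr p * (K + L)" for n
    proof -
      have "energy (\<lambda>x. a n x + b n x) \<le> 2 powr p * (energy (a n) + energy (b n))"
        by (intro dirichlet_add(2) finitely_supported_dirichlet a b)
      also have "\<dots> \<le> 2 powr p * (K + L)" by (intro mult_left_mono add_mono a b) simp
      finally show ?thesis .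
    qed
    show "(\<lambda>n. a n x + b n x) \<longlonglongrightarrow> f x + g x" for x by (intro tendsto_add a(3) b(3))
  qed
  then show ?thesis
    using BD_add[OF BD\<^sub>0_subset_BD[OF assms(1)] BD\<^sub>0_subset_BD[OF assms(2)]]
    by (simp add: BD\<^sub>0_iff BD_iff)
qed

lemma BD\<^sub>0_contraction:
  assumes f: "f \<in> BD\<^sub>0" and \<phi>: "\<And>a b. \<bar>\<phi> a - \<phi> b\<bar> \<le> \<bar>a - b\<bar>" and \<phi>0: "\<phi> 0 = 0"
  shows "(\<lambda>x. \<phi> (f x)) \<in> BD\<^sub>0"
proof -
  obtain a K where a: "\<And>n::nat. a n \<in> finitely_supported" "\<And>n. energy (a n) \<le> K" "\<And>x. (\<lambda>n. a n x) \<longlonglongrightarrow> f x"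
    by (rule BD\<^sub>0_approximation[OF f]) (rule that)
  have "(\<lambda>x. \<phi> (f x)) \<in> D_closure_fs E p o'"
  proof (rule D_closure_fs_weakI)
    show "(\<lambda>x. \<phi> (a n x)) \<in> finitely_supported" for n
    proof -
      have "{x. \<phi> (a n x) \<noteq> 0} \<subseteq> {x. a n x \<noteq> 0}" using \<phi>0 by auto
      then show ?thesis using a(1)[of n] by (auto simp: finitely_supported_def intro: finite_subset)
    qed
    show "energy (\<lambda>x. \<phi> (a n x)) \<le> K" for n
      using dirichlet_contraction(2)[OF finitely_supported_dirichlet[OF a(1)], of "\<lambda>x. \<phi> (a n x)" n] \<phi> a(2)[of n]
      by force
    show "(\<lambda>n. \<phi> (a n x)) \<longlonglongrightarrow> \<phi> (f x)" for x
    proof -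
      have "(\<lambda>n. \<bar>a n x - f x\<bar>) \<longlonglongrightarrow> 0"
        using a(3)[of x] by (simp add: LIM_zero_iff tendsto_rabs_zero_iff)
      then have "(\<lambda>n. \<phi> (a n x) - \<phi> (f x)) \<longlonglongrightarrow> 0"
        by (rule Lim_null_comparison[rotated]) (use \<phi> in auto)
      then show ?thesis by (simp add: LIM_zero_iff)
    qed
  qed
  then show ?thesis
    using BD_contraction[OF BD\<^sub>0_subset_BD[OF f] \<phi>] by (simp add: BD\<^sub>0_iff BD_iff)
qed

text \<open>
  The ideal property. Multiplication by \<open>g\<close> is compatible with weak approximation only for uniformly
  bounded approximants, so the approximants of \<open>f\<close> are first truncated at a bound for \<open>f\<close>.
\<close>
lemma BD\<^sub>0_mult:
  assumes f: "f \<in> BD\<^sub>0" and g: "g \<in> BD"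
  shows "(\<lambda>x. g x * f x) \<in> BD\<^sub>0"
proof -
  obtain a K where a: "\<And>n::nat. a n \<in> finitely_supported" "\<And>n. energy (a n) \<le> K" "\<And>x. (\<lambda>n. a n x) \<longlonglongrightarrow> f x"
    by (rule BD\<^sub>0_approximation[OF f]) (rule that)
  obtain M where M: "\<And>x. \<bar>f x\<bar> \<le> M" using f by (auto simp: BD\<^sub>0_iff)
  obtain B where B: "\<And>x. \<bar>g x\<bar> \<le> B" and dg: "dirichlet g" using g by (auto simp: BD_iff)
  have M0: "M \<ge> 0" using M[of undefined] by linarith
  define b where "b n = (\<lambda>x. clamp M (a n x))" for n
  have b: "b n \<in> finitely_supported" for n
  proof -
    have "{x. b n x \<noteq> 0} \<subseteq> {x. a n x \<noteq> 0}" using M0 by (auto simp: b_def clamp_0)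
    then show ?thesis using a(1)[of n] by (auto simp: finitely_supported_def intro: finite_subset)
  qed
  have bM: "\<bar>b n x\<bar> \<le> M" for n x using M0 by (simp add: b_def abs_clamp_le)
  have "(\<lambda>x. g x * f x) \<in> D_closure_fs E p o'"
  proof (rule D_closure_fs_weakI)
    show "(\<lambda>x. g x * b n x) \<in> finitely_supported" for n
      using b[of n] by (auto simp: finitely_supported_def elim: finite_subset[rotated])
    show "energy (\<lambda>x. g x * b n x) \<le> 2 powr p * (B powr p * K + M powr p * energy g)" for n
    proof -
      have "energy (b n) \<le> energy (a n)"
        unfolding b_def
        by (intro dirichlet_contraction(2) finitely_supported_dirichlet a clamp_contraction)
      then have "energy (b n) \<le> K" using a(2)[of n] by linarith
      have "energy (\<lambda>x. g x * b n x) \<le> 2 powr p * (B powr p * energy (b n) + M powr p * energy g)"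
        by (rule dirichlet_mult(2)[OF dg finitely_supported_dirichlet[OF b] B bM])
      also have "\<dots> \<le> 2 powr p * (B powr p * K + M powr p * energy g)"
        using \<open>energy (b n) \<le> K\<close> by (intro mult_left_mono add_mono) auto
      finally show ?thesis .
    qed
    show "(\<lambda>n. g x * b n x) \<longlonglongrightarrow> g x * f x" for x
    proof -
      have "(\<lambda>n. b n x) \<longlonglongrightarrow> clamp M (f x)" unfolding b_def by (intro tendsto_clamp a)
      then show ?thesis using M[of x] by (intro tendsto_mult) (auto simp: clamp_eq)
    qed
  qed
  then show ?thesis
    using BD_mult[OF g BD\<^sub>0_subset_BD[OF f]] by (simp add: BD\<^sub>0_iff BD_iff)
qed

lemma BD\<^sub>0_sum:
  assumes "finite I" "\<And>i. i \<in> I \<Longrightarrow> f i \<in> BD\<^sub>0"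
  shows "(\<lambda>x. \<Sum>i\<in>I. f i x) \<in> BD\<^sub>0"
  using assms
proof (induction I)
  case empty
  have "(\<lambda>x::'v. 0) \<in> finitely_supported" by (simp add: finitely_supported_def)
  then show ?case by (simp add: finitely_supported_BD\<^sub>0)
next
  case (insert i I)
  then show ?case by (simp add: BD\<^sub>0_add)
qed

section \<open>Characters on the harmonic boundary\<close>

text \<open>
  If \<open>j\<close> had modulus at least one wherever \<open>\<bar>f\<bar>\<close> exceeds \<open>\<epsilon>\<close>, then \<open>min \<bar>j\<bar> 1\<close>, an element of the ideal,
  would act as a unit on \<open>f - clamp \<epsilon> f\<close>, which would therefore belong to the ideal.
\<close>
lemma BD\<^sub>0_small_where_BD_large:
  assumes f: "f \<in> BD" and notin: "(\<lambda>x. f x - clamp \<epsilon> (f x)) \<notin> BD\<^sub>0" and j: "j \<in> BD\<^sub>0"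
  shows "\<exists>x. \<bar>j x\<bar> < 1 \<and> \<epsilon> < \<bar>f x\<bar>"
proof (rule ccontr)
  assume contra: "\<not> ?thesis"
  let ?s = "\<lambda>x. f x - clamp \<epsilon> (f x)" and ?m = "\<lambda>x. min \<bar>j x\<bar> 1"
  have "?m \<in> BD\<^sub>0"
    by (rule BD\<^sub>0_contraction[OF j, of "\<lambda>t. min \<bar>t\<bar> 1"]) (auto simp: min_def)
  then have "(\<lambda>x. ?s x * ?m x) \<in> BD\<^sub>0"
    by (rule BD\<^sub>0_mult) (rule BD_contraction[OF f diff_clamp_contraction])
  also have "(\<lambda>x. ?s x * ?m x) = ?s"
  proof
    fix x show "?s x * ?m x = ?s x"
    proof (cases "\<epsilon> < \<bar>f x\<bar>")
      case True
      with contra have "1 \<le> \<bar>j x\<bar>" by (auto simp: not_less)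
      then show ?thesis by (simp add: min_absorb2)
    qed (simp add: clamp_eq)
  qed
  finally show False using notin by simp
qed

text \<open>
  A function outside the ideal, in the quantitative sense that \<open>f - clamp \<epsilon> f\<close> is outside, is detected
  by a point of the harmonic boundary. The character is a cluster point of evaluations: by the
  preceding lemma, and since sums of squares of elements of the ideal stay in the ideal, any
  finitely many elements of the ideal are small at a common vertex at which \<open>\<bar>f\<bar>\<close> exceeds \<open>\<epsilon>\<close>.
  Evaluations lie in a product of compact sets of reals, so by the finite intersection property some
  multiplicative functional \<open>T\<close> satisfies \<open>\<bar>T j\<bar> \<le> 1\<close> for all \<open>j\<close> in the ideal. By homogeneity \<open>T\<close>
  vanishes on the ideal; in particular it vanishes on indicators of vertices and is not itself an
  evaluation. Being a limit of evaluations, it takes real values.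
\<close>
lemma harmonic_boundary_separates:
  assumes f: "f \<in> BD" and \<epsilon>: "\<epsilon> > 0" and notin: "(\<lambda>x. f x - clamp \<epsilon> (f x)) \<notin> BD\<^sub>0"
  obtains \<tau> where "\<tau> \<in> harmonic_boundary E p o'" "\<And>g. g \<in> BD \<Longrightarrow> \<tau> g \<in> \<real>" "\<epsilon> \<le> cmod (\<tau> f)"
proof -
  (* The ambient type contains unbounded functions, on which the value of an evaluation
     is set to zero to keep the product compact. *)
  define K where "K h = (if bounded (range h) then closure (range h) else {0})" for h :: "'v \<Rightarrow> real"
  define ev where "ev x h = (if bounded (range h) then h x else 0)" for x and h :: "'v \<Rightarrow> real"
  have ev: "ev x h = h x" if "h \<in> BD" for x h
    using that by (simp add: ev_def BD_space_def bounded_functions_def)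
  have "compact (K h)" for h by (auto simp: K_def)
  then have "compactin (product_topology (\<lambda>_. euclidean) UNIV) (PiE UNIV K)"
    unfolding compactin_PiE by (simp add: compactin_euclidean_iff)
  then have compact: "compact (PiE UNIV K)"
    by (simp add: euclidean_product_topology compactin_euclidean_iff)
  define Q where "Q = (\<Inter>g\<in>BD. \<Inter>h\<in>BD. {T. T (\<lambda>x. g x + h x) = T g + T h})
      \<inter> (\<Inter>g\<in>BD. \<Inter>h\<in>BD. {T. T (\<lambda>x. g x * h x) = T g * T h})
      \<inter> (\<Inter>c. \<Inter>g\<in>BD. {T. T (\<lambda>x. c * g x) = c * T g}) \<inter> {T. \<epsilon> \<le> \<bar>T f\<bar>}"
  note cont = continuous_on_product_coordinates
  have closed_Q: "closed Q"
    unfolding Q_def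
    by (intro closed_Int closed_INT ballI closed_Collect_eq closed_Collect_le continuous_intros cont)
  have evK: "ev x \<in> PiE UNIV K" for x
  proof -
    have "h x \<in> closure (range h)" for h :: "'v \<Rightarrow> real" by (rule subsetD[OF closure_subset]) simp
    then show ?thesis by (simp add: PiE_def Pi_def ev_def K_def)
  qed
  have evQ: "ev x \<in> Q" if "\<epsilon> < \<bar>f x\<bar>" for x
    unfolding Q_def
  proof (intro IntI INT_I CollectI)
    show "\<epsilon> \<le> \<bar>ev x f\<bar>" using that by (simp add: ev[OF f])
  next
    fix g h assume gh: "g \<in> BD" "h \<in> BD"
    show "ev x (\<lambda>x. g x + h x) = ev x g + ev x h"
      using gh by (simp add: ev[OF BD_add[OF gh]] ev)
  next
    fix g h assume gh: "g \<in> BD" "h \<in> BD"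
    show "ev x (\<lambda>x. g x * h x) = ev x g * ev x h"
      using gh by (simp add: ev[OF BD_mult[OF gh]] ev)
  next
    fix c g assume g: "g \<in> BD"
    show "ev x (\<lambda>x. c * g x) = c * ev x g"
      using g by (simp add: ev[OF BD_mult[OF BD_const g]] ev)
  qed
  have "(PiE UNIV K \<inter> Q) \<inter> (\<Inter>j\<in>BD\<^sub>0. {T. \<bar>T j\<bar> \<le> 1}) \<noteq> {}"
  proof (rule compact_imp_fip_image)
    show "compact (PiE UNIV K \<inter> Q)" by (rule compact_Int_closed[OF compact closed_Q])
    show "closed {T. \<bar>T j\<bar> \<le> (1::real)}" for j :: "'v \<Rightarrow> real"
      by (intro closed_Collect_le continuous_intros cont)
    fix I assume I: "finite I" "I \<subseteq> BD\<^sub>0"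
    have "(\<lambda>x. \<Sum>j\<in>I. j x * j x) \<in> BD\<^sub>0"
      using I by (intro BD\<^sub>0_sum BD\<^sub>0_mult) (auto intro: BD\<^sub>0_subset_BD)
    from BD\<^sub>0_small_where_BD_large[OF f notin this]
    obtain x where x: "\<bar>\<Sum>j\<in>I. j x * j x\<bar> < 1" "\<epsilon> < \<bar>f x\<bar>" by blast
    have "\<bar>ev x j\<bar> \<le> 1" if "j \<in> I" for j
    proof -
      have "j x * j x \<le> (\<Sum>j\<in>I. j x * j x)"
        using I(1) that by (intro member_le_sum) auto
      then have "(j x)\<^sup>2 \<le> 1" using x(1) by (simp add: power2_eq_square)
      then have "\<bar>j x\<bar> \<le> 1" by (simp add: abs_square_le_1)
      then show ?thesis using that I by (simp add: ev BD\<^sub>0_subset_BD subset_iff)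
    qed
    then show "PiE UNIV K \<inter> Q \<inter> (\<Inter>j\<in>I. {T. \<bar>T j\<bar> \<le> 1}) \<noteq> {}"
      using evK[of x] evQ[OF x(2)] by blast
  qed
  then obtain T where T: "T \<in> Q" and T1: "\<And>j. j \<in> BD\<^sub>0 \<Longrightarrow> \<bar>T j\<bar> \<le> 1" by blast
  have add: "T (\<lambda>x. g x + h x) = T g + T h" and mult: "T (\<lambda>x. g x * h x) = T g * T h"
    if "g \<in> BD" "h \<in> BD" for g h
    using T that by (auto simp: Q_def)
  have scale: "T (\<lambda>x. c * g x) = c * T g" if "g \<in> BD" for g c
    using T that by (auto simp: Q_def)
  have Tf: "\<epsilon> \<le> \<bar>T f\<bar>" using T by (auto simp: Q_def)
  have T0: "T j = 0" if "j \<in> BD\<^sub>0" for j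
  proof (rule ccontr)
    assume "T j \<noteq> 0"
    have "(\<lambda>x. (2 / T j) * j x) \<in> BD\<^sub>0" by (rule BD\<^sub>0_mult[OF that BD_const])
    from T1[OF this] have "\<bar>(2 / T j) * T j\<bar> \<le> 1"
      unfolding scale[OF BD\<^sub>0_subset_BD[OF that]] .
    then show False using \<open>T j \<noteq> 0\<close> by simp
  qed
  define \<tau> where "\<tau> = (\<lambda>h\<in>BD. complex_of_real (T h))"
  have \<tau>: "\<tau> h = complex_of_real (T h)" if "h \<in> BD" for h using that by (simp add: \<tau>_def)
  have nz: "\<tau> f \<noteq> 0" using Tf \<epsilon> by (auto simp: \<tau>[OF f])
  have "\<tau> \<in> BD_spectrum E p"
    unfolding BD_spectrum_def
  proof (intro CollectI conjI ballI allI)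
    show "\<tau> \<in> extensional BD" by (simp add: \<tau>_def)
    show "\<exists>f\<in>BD. \<tau> f \<noteq> 0" using f nz by blast
  next
    fix g h assume gh: "g \<in> BD" "h \<in> BD"
    show "\<tau> (\<lambda>x. g x + h x) = \<tau> g + \<tau> h"
      by (simp add: \<tau>[OF BD_add[OF gh]] \<tau>[OF gh(1)] \<tau>[OF gh(2)] add[OF gh])
    show "\<tau> (\<lambda>x. g x * h x) = \<tau> g * \<tau> h"
      by (simp add: \<tau>[OF BD_mult[OF gh]] \<tau>[OF gh(1)] \<tau>[OF gh(2)] mult[OF gh])
  next
    fix c g assume g: "g \<in> BD"
    show "\<tau> (\<lambda>x. c * g x) = complex_of_real c * \<tau> g"
      by (simp add: \<tau>[OF BD_mult[OF BD_const g]] \<tau>[OF g] scale[OF g])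
  qed
  moreover have "\<tau> \<notin> range (point_eval E p)"
  proof
    assume "\<tau> \<in> range (point_eval E p)"
    then obtain x where x: "\<tau> = point_eval E p x" by blast
    have i: "indicator {x} \<in> BD\<^sub>0"
      by (rule finitely_supported_BD\<^sub>0) (simp add: finitely_supported_def indicator_def)
    have "\<tau> (indicator {x}) = 1"
      using BD\<^sub>0_subset_BD[OF i] by (simp add: x point_eval_def)
    then show False using T0[OF i] BD\<^sub>0_subset_BD[OF i] by (simp add: \<tau>)
  qed
  ultimately have "\<tau> \<in> harmonic_boundary E p o'"
    using T0 BD\<^sub>0_subset_BD by (auto simp: harmonic_boundary_def royden_boundary_def \<tau>)
  then show thesis
    by (rule that) (use Tf f in \<open>auto simp: \<tau>\<close>)
qed

lemma BD_spectrum_hom: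
  assumes "\<tau> \<in> BD_spectrum E p" "f \<in> BD" "g \<in> BD"
  shows "\<tau> (\<lambda>x. f x + g x) = \<tau> f + \<tau> g" and "\<tau> (\<lambda>x. f x * g x) = \<tau> f * \<tau> g"
    and "\<tau> (\<lambda>x. c * f x) = complex_of_real c * \<tau> f"
  using assms by (simp_all add: BD_spectrum_def)

lemma BD_spectrum_const:
  assumes \<tau>: "\<tau> \<in> BD_spectrum E p"
  shows "\<tau> (\<lambda>x. c) = complex_of_real c"
proof -
  obtain f where f: "f \<in> BD" "\<tau> f \<noteq> 0" using \<tau> by (auto simp: BD_spectrum_def)
  have "\<tau> (\<lambda>x. 1) = 1"
    using BD_spectrum_hom(2)[OF \<tau> f(1) BD_const[of 1]] f(2) by simp
  then show ?thesis
    using BD_spectrum_hom(3)[OF \<tau> BD_const[of 1] BD_const[of 1], of c] by simp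
qed

lemma BD_spectrum_add_const:
  assumes "\<tau> \<in> BD_spectrum E p" "f \<in> BD"
  shows "\<tau> (\<lambda>x. f x + c) = \<tau> f + complex_of_real c"
  using BD_spectrum_hom(1)[OF assms BD_const[of c]] BD_spectrum_const[OF assms(1)] by simp

section \<open>At most one boundary point forces constant harmonic functions\<close>

lemma p_harmonic_eq_const:
  assumes f: "dirichlet f" and edge: "\<And>x y. E x y \<Longrightarrow> f x = f y"
  shows "\<exists>c. f = (\<lambda>x. c)"
proof -
  have "f x = f o'" for x
  proof -
    have "E\<^sup>*\<^sup>* o' x" using connected_E by (simp add: connected_graph_def)
    then show ?thesis by induction (auto dest: edge)
  qed
  then show ?thesis by blast
qed

text \<open>
  With at most one boundary point \<open>\<tau>\<close>, put \<open>u = f - c\<close> with \<open>c = \<tau> f\<close>. No boundary point detects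
  \<open>u\<close>, so \<open>u - clamp \<epsilon> u\<close> lies in the ideal for every \<open>\<epsilon>\<close>, where the pairing with \<open>h\<close> vanishes.
  What is left is the pairing with \<open>clamp \<epsilon> u\<close>, which tends to zero with \<open>\<epsilon>\<close> by dominated
  convergence.
\<close>
lemma pairing_BD_eq_0:
  assumes h: "dirichlet h" "p_harmonic E p h" and f: "f \<in> BD"
    and unique: "\<And>\<sigma> \<tau>. \<sigma> \<in> harmonic_boundary E p o' \<Longrightarrow> \<tau> \<in> harmonic_boundary E p o' \<Longrightarrow> \<sigma> = \<tau>"
  shows "pairing h f = 0"
proof -
  (* If the boundary is empty, the separation lemma puts f - clamp \<epsilon> f into the ideal
     for every f, so any constant serves. *)
  define c where "c = (if harmonic_boundary E p o' = {} then 0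
                       else Re ((SOME \<tau>. \<tau> \<in> harmonic_boundary E p o') f))"
  define u where "u = (\<lambda>x. f x + (- c))"
  have u: "u \<in> BD" unfolding u_def by (rule BD_add[OF f BD_const])
  then have du: "dirichlet u" by (simp add: BD_iff)
  have in0: "(\<lambda>x. u x - clamp \<epsilon> (u x)) \<in> BD\<^sub>0" if "\<epsilon> > 0" for \<epsilon>
  proof (rule ccontr)
    assume "(\<lambda>x. u x - clamp \<epsilon> (u x)) \<notin> BD\<^sub>0"
    from harmonic_boundary_separates[OF u that this]
    obtain \<tau> where \<tau>: "\<tau> \<in> harmonic_boundary E p o'" "\<And>g. g \<in> BD \<Longrightarrow> \<tau> g \<in> \<real>" "\<epsilon> \<le> cmod (\<tau> u)"
      by metis
    have "(SOME \<tau>. \<tau> \<in> harmonic_boundary E p o') = \<tau>"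
      by (rule unique[OF someI[of _ \<tau>] \<tau>(1)]) (rule \<tau>(1))
    then have "c = Re (\<tau> f)" using \<tau>(1) by (auto simp: c_def)
    then have "\<tau> f = complex_of_real c" using \<tau>(2)[OF f] by simp
    moreover have "\<tau> \<in> BD_spectrum E p"
      using \<tau>(1) by (simp add: harmonic_boundary_def royden_boundary_def)
    then have "\<tau> u = \<tau> f + complex_of_real (- c)"
      unfolding u_def by (rule BD_spectrum_add_const[OF _ f])
    ultimately have "\<tau> u = 0" by simp
    with \<tau>(3) that show False by simp
  qed
  define e where "e n = inverse (real (Suc n))" for n
  have e: "e n > 0" "e \<longlonglongrightarrow> 0" for n
    unfolding e_def using LIMSEQ_inverse_real_of_nat by auto
  have dclamp: "dirichlet (\<lambda>x. clamp (e n) (u x))" for n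
    by (rule dirichlet_contraction(1)[OF du clamp_contraction])
  have eq: "pairing h u = pairing h (\<lambda>x. clamp (e n) (u x))" for n
  proof -
    let ?s = "\<lambda>x. u x - clamp (e n) (u x)"
    have s: "?s \<in> BD\<^sub>0" by (rule in0[OF e(1)])
    have "pairing h (\<lambda>x. ?s x + clamp (e n) (u x)) = pairing h ?s + pairing h (\<lambda>x. clamp (e n) (u x))"
      by (rule pairing_add[OF h(1) _ dclamp]) (use BD\<^sub>0_subset_BD[OF s] in \<open>simp add: BD_iff\<close>)
    moreover have "pairing h ?s = 0"
      by (rule pairing_D_closure[OF h]) (use s in \<open>simp add: BD\<^sub>0_iff\<close>)
    ultimately show ?thesis by simp
  qed
  have "(\<lambda>n. pairing h (\<lambda>x. clamp (e n) (u x))) \<longlonglongrightarrow> (\<integral>e. 0 \<partial>count_space edges)"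
    unfolding pairing_def
  proof (rule integral_dominated_convergence)
    show "integrable (count_space edges) (\<lambda>a. \<bar>flux p (grad h a) * grad u a\<bar>)"
      by (intro integrable_abs integrable_pairing h du)
    show "AE a in count_space edges. (\<lambda>n. flux p (grad h a) * grad (\<lambda>x. clamp (e n) (u x)) a) \<longlonglongrightarrow> 0"
    proof (intro AE_I2 tendsto_mult_right_zero)
      fix a
      have "(\<lambda>n. clamp (e n) (u x)) \<longlonglongrightarrow> 0" for x
        by (rule Lim_null_comparison[OF always_eventually e(2)])
           (use e(1)[THEN less_imp_le] in \<open>simp add: abs_clamp_le\<close>)
      from tendsto_diff[OF this this]
      show "(\<lambda>n. grad (\<lambda>x. clamp (e n) (u x)) a) \<longlonglongrightarrow> 0"
        unfolding grad_def by simp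
    qed
    show "AE a in count_space edges. norm (flux p (grad h a) * grad (\<lambda>x. clamp (e n) (u x)) a)
        \<le> \<bar>flux p (grad h a) * grad u a\<bar>" for n
      by (intro AE_I2) (auto simp: abs_mult grad_def intro!: mult_left_mono clamp_contraction)
  qed auto
  then have "(\<lambda>n::nat. pairing h u) \<longlonglongrightarrow> 0" by (simp add: eq[symmetric])
  then have "pairing h u = 0" by (simp add: LIMSEQ_const_iff)
  then show ?thesis by (simp only: u_def pairing_add_const)
qed

text \<open>
  The pairing of \<open>h\<close> with its truncation vanishes. Since truncation is monotone, all its terms are
  nonnegative, so each of them is zero. Truncating above the values of \<open>h\<close> at the ends of a given
  edge leaves the difference along that edge unchanged, and this difference must be zero. Thus
  unbounded \<open>h\<close> are treated as well.
\<close>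
lemma HD_const_of_unique_boundary_point:
  assumes h: "dirichlet h" "p_harmonic E p h"
    and unique: "\<And>\<sigma> \<tau>. \<sigma> \<in> harmonic_boundary E p o' \<Longrightarrow> \<tau> \<in> harmonic_boundary E p o' \<Longrightarrow> \<sigma> = \<tau>"
  shows "\<exists>c. h = (\<lambda>x. c)"
proof (rule p_harmonic_eq_const[OF h(1)])
  fix x y assume xy: "E x y"
  define M where "M = max \<bar>h x\<bar> \<bar>h y\<bar>"
  have M0: "M \<ge> 0" unfolding M_def by (rule order_trans[OF abs_ge_zero max.cobounded1])
  let ?c = "\<lambda>x. clamp M (h x)"
  have dc: "dirichlet ?c" by (rule dirichlet_contraction(1)[OF h(1) clamp_contraction])
  have c: "?c \<in> BD" using dc abs_clamp_le[OF M0] by (auto simp: BD_iff)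
  have nonneg: "0 \<le> flux p (grad h e) * grad ?c e" for e
  proof -
    have "grad h e \<ge> 0 \<Longrightarrow> grad ?c e \<ge> 0" "grad h e \<le> 0 \<Longrightarrow> grad ?c e \<le> 0"
      by (auto simp: grad_def clamp_def max_def min_def)
    then show ?thesis
      by (cases "grad h e \<ge> 0") (auto simp: flux_def mult_nonneg_nonpos zero_le_mult_iff mult_le_0_iff)
  qed
  have "AE e in count_space edges. flux p (grad h e) * grad ?c e = 0"
  proof (rule integral_nonneg_eq_0_iff_AE[THEN iffD1])
    show "integrable (count_space edges) (\<lambda>e. flux p (grad h e) * grad ?c e)"
      by (rule integrable_pairing[OF h(1) dc])
    show "(\<integral>e. flux p (grad h e) * grad ?c e \<partial>count_space edges) = 0"
      using pairing_BD_eq_0[OF h c unique] by (simp add: pairing_def)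
  qed (use nonneg in auto)
  then have "flux p (grad h (x, y)) * grad ?c (x, y) = 0"
    using xy by (simp add: AE_count_space edges_def)
  moreover have "grad ?c (x, y) = grad h (x, y)"
    by (simp add: grad_def clamp_eq M_def)
  ultimately show "h x = h y" by (auto simp: flux_def grad_def)
qed

section \<open>Harmonic representatives of bounded functions\<close>

text \<open>
  Varying \<open>v\<close> at the single vertex \<open>x\<close> changes only the finitely many edge terms at \<open>x\<close>, and the
  derivative of their sum is a multiple of the \<open>p\<close>-Laplacian.
\<close>
lemma energy_minimizer_p_harmonic:
  assumes v: "dirichlet v" and min: "\<And>x t. energy v \<le> energy (\<lambda>y. v y + t * indicator {x} y)"
  shows "p_harmonic E p v"
  unfolding p_harmonic_def
proof
  fix x
  define F where "F t = (\<Sum>y\<in>nbrs E x. \<bar>v y - v x - t\<bar> powr p)" for t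
  have di: "dirichlet (\<lambda>y. v y + t * indicator {x} y)" for t
    by (intro dirichlet_add(1) v dirichlet_cmult(1) finitely_supported_dirichlet)
       (simp add: finitely_supported_def indicator_def)
  have diff: "energy (\<lambda>y. v y + t * indicator {x} y) - energy v = 2 * (F t - F 0)" for t
  proof -
    let ?w = "\<lambda>e. \<bar>grad (\<lambda>y. v y + t * indicator {x} y) e\<bar> powr p - \<bar>grad v e\<bar> powr p"
    have "energy (\<lambda>y. v y + t * indicator {x} y) - energy v = (\<integral>e. ?w e \<partial>count_space edges)"
      using v di by (simp add: energy_def dirichlet_def)
    also have "\<dots> = 2 * (\<Sum>y\<in>nbrs E x. ?w (x, y))"
    proof (rule integral_edges_at_vertex)
      fix y z
      have "\<bar>grad g (y, z)\<bar> = \<bar>grad g (z, y)\<bar>" for g :: "'v \<Rightarrow> real"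
        by (simp add: grad_def abs_minus_commute)
      then show "?w (y, z) = ?w (z, y)" by (simp only:)
    qed (simp add: grad_def)
    also have "(\<Sum>y\<in>nbrs E x. ?w (x, y)) = (\<Sum>y\<in>nbrs E x. \<bar>v y - v x - t\<bar> powr p - \<bar>v y - v x - 0\<bar> powr p)"
      using irreflp_E
      by (intro sum.cong) (auto simp: grad_def nbrs_def irreflp_def indicator_def algebra_simps)
    finally show ?thesis by (simp add: F_def sum_subtractf)
  qed
  have "((\<lambda>t. \<bar>v y - v x - t\<bar> powr p) has_real_derivative (p * flux p (v y - v x - 0)) * (- 1)) (at 0)" for y
    by (rule DERIV_chain2[where f = "\<lambda>s. \<bar>s\<bar> powr p", OF abs_powr_has_derivative[OF p_gt_1]])
       (auto intro!: derivative_eq_intros)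
  then have "(F has_real_derivative (\<Sum>y\<in>nbrs E x. (p * flux p (v y - v x - 0)) * (- 1))) (at 0)"
    unfolding F_def by (intro DERIV_sum)
  moreover have "\<forall>t. \<bar>0 - t\<bar> < 1 \<longrightarrow> F 0 \<le> F t"
    using min[where x = x] diff by (smt (verit))
  ultimately have "(\<Sum>y\<in>nbrs E x. (p * flux p (v y - v x - 0)) * (- 1)) = 0"
    by (rule DERIV_local_min[OF _ zero_less_one])
  then have "p * (\<Sum>y\<in>nbrs E x. flux p (v y - v x)) = 0"
    by (simp add: sum_negf sum_distrib_left)
  then show "p_laplacian E p v x = 0"
    using p_gt_1 by (simp add: p_laplacian_def flux_def)
qed

lemma energy_add_perturb:
  assumes "dirichlet u" "dirichlet v" "0 < t" "t < 1"
  shows "energy (\<lambda>x. u x + v x) \<le> (1 - t) powr (1 - p) * energy u + t powr (1 - p) * energy v"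
proof -
  let ?h = "\<lambda>e. (1 - t) powr (1 - p) * \<bar>grad u e\<bar> powr p + t powr (1 - p) * \<bar>grad v e\<bar> powr p"
  have int: "integrable (count_space edges) ?h" using assms by (auto simp: dirichlet_def)
  have le: "\<bar>grad (\<lambda>x. u x + v x) e\<bar> powr p \<le> ?h e" for e
  proof -
    have "grad (\<lambda>x. u x + v x) e = grad u e + grad v e" by (simp add: grad_def)
    then show ?thesis by (simp only: abs_add_powr_perturb[OF p_gt_1 assms(3,4)])
  qed
  show ?thesis
    using dirichlet_bound(2)[OF int le] assms by (simp add: energy_def dirichlet_def)
qed

text \<open>
  Royden's decomposition. Among the functions that differ from \<open>f\<close> by a finitely supported function and
  respect the bound of \<open>f\<close>, take a minimizing sequence that is Cauchy in energy; boundedness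
  yields a subsequence that converges at \<open>o'\<close>, hence everywhere. Truncation never increases
  the energy, so the limit \<open>v\<close> also minimizes the energy against arbitrary finitely supported
  perturbations and is therefore harmonic.
\<close>
lemma royden_decomposition:
  assumes f: "f \<in> BD"
  obtains v where "dirichlet v" "p_harmonic E p v" "(\<lambda>x. f x - v x) \<in> BD\<^sub>0"
proof -
  obtain M where M: "\<And>x. \<bar>f x\<bar> \<le> M" and df: "dirichlet f" using f by (auto simp: BD_iff)
  have M0: "M \<ge> 0" using M[of o'] by linarith
  define A where "A = {u. (\<lambda>x. f x - u x) \<in> finitely_supported}"
  define C where "C = {u \<in> A. \<forall>x. \<bar>u x\<bar> \<le> M}"
  have dA: "dirichlet u" if "u \<in> A" for u
  proof -
    have "dirichlet (\<lambda>x. f x - u x)"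
      using that by (intro finitely_supported_dirichlet) (simp add: A_def)
    from dirichlet_diff(1)[OF df this] show ?thesis by simp
  qed
  have clampC: "(\<lambda>x. clamp M (u x)) \<in> C" if "u \<in> A" for u
  proof -
    have "{x. f x - clamp M (u x) \<noteq> 0} \<subseteq> {x. f x - u x \<noteq> 0}"
      by (rule Collect_mono) (metis M clamp_eq right_minus_eq)
    then show ?thesis
      using that abs_clamp_le[OF M0]
      by (auto simp: C_def A_def finitely_supported_def intro: finite_subset)
  qed
  have fC: "f \<in> C" using M by (auto simp: C_def A_def finitely_supported_def)
  have midC: "(\<lambda>x. (u x + v x) / 2) \<in> C" if "u \<in> C" "v \<in> C" for u v
  proof -
    have "{x. f x - (u x + v x) / 2 \<noteq> 0} \<subseteq> {x. f x - u x \<noteq> 0} \<union> {x. f x - v x \<noteq> 0}"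
      by (auto simp: field_simps)
    moreover have "\<bar>(u x + v x) / 2\<bar> \<le> M" for x
    proof -
      have "\<bar>u x\<bar> \<le> M" "\<bar>v x\<bar> \<le> M" using that by (auto simp: C_def)
      then show ?thesis by (auto simp: abs_le_iff)
    qed
    ultimately show ?thesis
      using that by (auto simp: C_def A_def finitely_supported_def intro: finite_subset)
  qed
  obtain w where wC: "\<And>n. w n \<in> C"
    and w_min: "\<And>n u. u \<in> C \<Longrightarrow> energy (w n) \<le> energy u + inverse (real (Suc n))"
    and w_cauchy: "\<And>\<epsilon>. \<epsilon> > 0 \<Longrightarrow> \<exists>N. \<forall>i\<ge>N. \<forall>j\<ge>N. energy (\<lambda>x. w i x - w j x) < \<epsilon>"
    by (rule energy_cauchy_selection[of "\<lambda>n. C" "energy f"])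
       (use fC midC dA in \<open>auto simp: C_def\<close>)
  have "bounded (range (\<lambda>n. w n o'))"
    using wC by (auto simp: bounded_iff C_def)
  then obtain r l where r: "strict_mono r" and l: "((\<lambda>n. w n o') \<circ> r) \<longlonglongrightarrow> l"
    using bounded_imp_convergent_subsequence by blast
  define z where "z n = w (r n)" for n
  have zC: "z n \<in> C" for n by (simp add: z_def wC)
  have zA: "z n \<in> A" and dz: "dirichlet (z n)" for n
    using zC[of n] dA by (auto simp: C_def)
  have z_cauchy: "\<exists>N. \<forall>i\<ge>N. \<forall>j\<ge>N. energy (\<lambda>x. z i x - z j x) < \<epsilon>" if "\<epsilon> > 0" for \<epsilon>
    using w_cauchy[OF that] seq_suble[OF r] unfolding z_def by (meson order_trans)
  have conv: "convergent (\<lambda>n. z n o')" using l by (auto simp: z_def o_def convergent_def)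
  have "convergent (\<lambda>n. z n x)" for x
    by (rule energy_cauchy_pointwise[OF dz _ conv]) (rule z_cauchy)
  then obtain v where v: "\<And>x. (\<lambda>n. z n x) \<longlonglongrightarrow> v x"
    unfolding convergent_def by metis
  have dv: "dirichlet v"
    by (rule energy_cauchy_limit(1)[OF dz _ v]) (rule z_cauchy)
  have lim: "(\<lambda>n. energy (\<lambda>x. z n x - v x)) \<longlonglongrightarrow> 0"
    by (rule energy_cauchy_limit(2)[OF dz _ v]) (rule z_cauchy)
  have "(\<lambda>x. f x - v x) \<in> D_closure_fs E p o'"
  proof (rule D_closure_fsI)
    show "dirichlet (\<lambda>x. f x - v x)" by (rule dirichlet_diff(1)[OF df dv])
    show "(\<lambda>x. f x - z n x) \<in> finitely_supported" for n using zA by (simp add: A_def)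
    show "(\<lambda>n. energy (\<lambda>x. (f x - v x) - (f x - z n x))) \<longlonglongrightarrow> 0"
      using lim by (simp add: algebra_simps)
    show "(\<lambda>n. f o' - z n o') \<longlonglongrightarrow> f o' - v o'" by (intro tendsto_intros v)
  qed
  moreover have "\<bar>f x - v x\<bar> \<le> M + M" for x
  proof -
    have "\<bar>v x\<bar> \<le> M"
    proof (rule LIMSEQ_le_const2)
      show "(\<lambda>n. \<bar>z n x\<bar>) \<longlonglongrightarrow> \<bar>v x\<bar>" by (intro tendsto_rabs v)
    qed (use zC in \<open>auto simp: C_def\<close>)
    then show ?thesis using M[of x] by linarith
  qed
  ultimately have in0: "(\<lambda>x. f x - v x) \<in> BD\<^sub>0" by (auto simp: BD\<^sub>0_iff)
  have z_min: "energy (z n) \<le> energy u + inverse (real (Suc n))" if "u \<in> A" for u n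
  proof -
    have "energy (z n) \<le> energy (\<lambda>x. clamp M (u x)) + inverse (real (Suc (r n)))"
      unfolding z_def by (rule w_min[OF clampC[OF that]])
    moreover have "energy (\<lambda>x. clamp M (u x)) \<le> energy u"
      by (rule dirichlet_contraction(2)[OF dA[OF that] clamp_contraction])
    moreover have "inverse (real (Suc (r n))) \<le> inverse (real (Suc n))"
      using seq_suble[OF r, of n] by (intro le_imp_inverse_le) auto
    ultimately show ?thesis by linarith
  qed
  have harmonic: "p_harmonic E p v"
  proof (rule energy_minimizer_p_harmonic[OF dv])
    fix x :: 'v and t :: real
    let ?g = "\<lambda>y::'v. t * indicator {x} y :: real"
    have g: "?g \<in> finitely_supported"
      by (simp add: finitely_supported_def indicator_def)
    have dvg: "dirichlet (\<lambda>y. v y + ?g y)"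
      by (rule dirichlet_add(1)[OF dv finitely_supported_dirichlet[OF g]])
    (* The perturbed minimizing sequence differs from the perturbed limit by a term of
       vanishing energy; the factor depending on s pays for it and disappears as s tends to 0. *)
    have bound: "energy v \<le> (1 - s) powr (1 - p) * energy (\<lambda>y. v y + ?g y)" if s: "0 < s" "s < 1" for s
    proof -
      define R where "R n = (1 - s) powr (1 - p) * energy (\<lambda>y. v y + ?g y)
        + s powr (1 - p) * energy (\<lambda>y. z n y - v y) + inverse (real (Suc n))" for n
      have "R \<longlonglongrightarrow> (1 - s) powr (1 - p) * energy (\<lambda>y. v y + ?g y) + s powr (1 - p) * 0 + 0"
        unfolding R_def by (intro tendsto_intros lim LIMSEQ_inverse_real_of_nat)
      then have R: "R \<longlonglongrightarrow> (1 - s) powr (1 - p) * energy (\<lambda>y. v y + ?g y)" by simp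
      have le: "energy (z n) \<le> R n" for n
      proof -
        have "(\<lambda>y. z n y + ?g y) \<in> A"
        proof -
          have "{y. f y - (z n y + ?g y) \<noteq> 0} \<subseteq> {y. f y - z n y \<noteq> 0} \<union> {y. ?g y \<noteq> 0}" by auto
          then show ?thesis
            using zA[of n] g by (auto simp: A_def finitely_supported_def intro: finite_subset)
        qed
        from z_min[OF this, of n]
        have "energy (z n) \<le> energy (\<lambda>y. (v y + ?g y) + (z n y - v y)) + inverse (real (Suc n))"
          by (simp add: algebra_simps)
        also have "\<dots> \<le> R n"
          unfolding R_def
          by (intro add_right_mono energy_add_perturb dvg dirichlet_diff(1) dz dv s)
        finally show ?thesis .
      qed
      show ?thesis
      proof (rule field_le_epsilon)
        fix e :: real assume "e > 0"
        then have "\<forall>\<^sub>F n in sequentially. R n < (1 - s) powr (1 - p) * energy (\<lambda>y. v y + ?g y) + e"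
          by (intro order_tendstoD(2)[OF R]) simp
        then have "\<forall>\<^sub>F n in sequentially. energy (z n) \<le> (1 - s) powr (1 - p) * energy (\<lambda>y. v y + ?g y) + e"
          by (rule eventually_mono) (use le in \<open>meson less_imp_le order_trans\<close>)
        then show "energy v \<le> (1 - s) powr (1 - p) * energy (\<lambda>y. v y + ?g y) + e"
          by (rule dirichlet_Fatou(2)[OF dz v])
      qed
    qed
    have "((\<lambda>s. (1 - s) powr (1 - p) * energy (\<lambda>y. v y + ?g y)) \<longlongrightarrow>
        (1 - 0) powr (1 - p) * energy (\<lambda>y. v y + ?g y)) (at_right 0)"
      by (intro tendsto_intros) auto
    then have "energy v \<le> (1 - 0) powr (1 - p) * energy (\<lambda>y. v y + ?g y)"
    proof (rule tendsto_lowerbound)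
      show "\<forall>\<^sub>F s in at_right 0. energy v \<le> (1 - s) powr (1 - p) * energy (\<lambda>y. v y + ?g y)"
        by (rule eventually_at_rightI[of 0 1]) (use bound in auto)
    qed simp
    then show "energy v \<le> energy (\<lambda>y. v y + ?g y)" by simp
  qed
  show thesis by (rule that[OF dv harmonic in0])
qed

text \<open>
  If the harmonic part of \<open>f\<close> is a constant \<open>c\<close>, then every point of the harmonic boundary takes the
  value \<open>c\<close> at \<open>f\<close>.
\<close>
lemma unique_boundary_point_of_HD_const:
  assumes const: "\<And>h. dirichlet h \<Longrightarrow> p_harmonic E p h \<Longrightarrow> \<exists>c. h = (\<lambda>x. c)"
    and \<sigma>: "\<sigma> \<in> harmonic_boundary E p o'" and \<tau>: "\<tau> \<in> harmonic_boundary E p o'"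
  shows "\<sigma> = \<tau>"
proof (rule extensionalityI[of _ BD])
  have spec: "\<rho> \<in> BD_spectrum E p" if "\<rho> \<in> harmonic_boundary E p o'" for \<rho>
    using that by (simp add: harmonic_boundary_def royden_boundary_def)
  show "\<sigma> \<in> extensional BD" "\<tau> \<in> extensional BD"
    using spec[OF \<sigma>] spec[OF \<tau>] by (simp_all add: BD_spectrum_def)
  fix f assume f: "f \<in> BD"
  obtain v where v: "dirichlet v" "p_harmonic E p v" "(\<lambda>x. f x - v x) \<in> BD\<^sub>0"
    by (rule royden_decomposition[OF f])
  obtain c where "v = (\<lambda>x. c)" using const[OF v(1,2)] by blast
  with v(3) have fc: "(\<lambda>x. f x - c) \<in> BD\<^sub>0" by simp
  have val: "\<rho> f = complex_of_real c" if "\<rho> \<in> harmonic_boundary E p o'" for \<rho>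
  proof -
    have "\<rho> (\<lambda>x. (f x - c) + c) = \<rho> (\<lambda>x. f x - c) + complex_of_real c"
      by (rule BD_spectrum_add_const[OF spec[OF that] BD\<^sub>0_subset_BD[OF fc]])
    moreover have "\<rho> (\<lambda>x. f x - c) = 0"
      using that fc by (simp add: harmonic_boundary_def)
    ultimately show ?thesis by simp
  qed
  show "\<sigma> f = \<tau> f" by (simp add: val[OF \<sigma>] val[OF \<tau>])
qed

lemma const_HD: "(\<lambda>x. c) \<in> HD_space E p"
  by (simp add: HD_space_def D_space_iff_dirichlet dirichlet_const p_harmonic_def p_laplacian_def)

lemma HD_eq_const_iff:
  "HD_space E p = {f. \<exists>c. f = (\<lambda>x. c)} \<longleftrightarrow>
    (\<forall>\<sigma>\<in>harmonic_boundary E p o'. \<forall>\<tau>\<in>harmonic_boundary E p o'. \<sigma> = \<tau>)"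
proof
  assume HD: "HD_space E p = {f. \<exists>c. f = (\<lambda>x. c)}"
  have "\<exists>c. h = (\<lambda>x. c)" if "dirichlet h" "p_harmonic E p h" for h
  proof -
    have "h \<in> HD_space E p" using that by (simp add: HD_space_def D_space_iff_dirichlet)
    then show ?thesis unfolding HD by simp
  qed
  then show "\<forall>\<sigma>\<in>harmonic_boundary E p o'. \<forall>\<tau>\<in>harmonic_boundary E p o'. \<sigma> = \<tau>"
    by (intro ballI unique_boundary_point_of_HD_const)
next
  assume unique: "\<forall>\<sigma>\<in>harmonic_boundary E p o'. \<forall>\<tau>\<in>harmonic_boundary E p o'. \<sigma> = \<tau>"
  have "\<exists>c. h = (\<lambda>x. c)" if "h \<in> HD_space E p" for h
    using that unique
    by (intro HD_const_of_unique_boundary_point) (auto simp: HD_space_def D_space_iff_dirichlet)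
  then show "HD_space E p = {f. \<exists>c. f = (\<lambda>x. c)}"
    using const_HD by blast
qed

end

theorem theorem2p5:
  fixes E :: "'v \<Rightarrow> 'v \<Rightarrow> bool" and p :: real and o' :: 'v
  assumes "p > 1"
    and "countable (UNIV :: 'v set)" and "infinite (UNIV :: 'v set)"
    and "symp E" and "irreflp E"
    and "connected_graph E" and "bounded_degree E"
  shows "HD_space E p = {f. \<exists>c::real. f = (\<lambda>x. c)} \<longleftrightarrow>
         finite (harmonic_boundary E p o') \<and>
         (card (harmonic_boundary E p o') = 0 \<or> card (harmonic_boundary E p o') = 1)"
proof -
  interpret dirichlet_graph E p o' using assms by unfold_locales
  have "(\<forall>\<sigma>\<in>A. \<forall>\<tau>\<in>A. \<sigma> = \<tau>) \<longleftrightarrow> finite A \<and> (card A = 0 \<or> card A = 1)"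
    for A :: "(('v \<Rightarrow> real) \<Rightarrow> complex) set"
  proof (cases "A = {}")
    case False
    then obtain a where "a \<in> A" by blast
    then have "(\<forall>\<sigma>\<in>A. \<forall>\<tau>\<in>A. \<sigma> = \<tau>) \<longleftrightarrow> A = {a}" by blast
    then show ?thesis using \<open>a \<in> A\<close> by (auto simp: card_1_singleton_iff)
  qed simp
  then show ?thesis by (simp only: HD_eq_const_iff)
qed

end
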